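(* Let $G_1$ and $G_2$ be two connected regular cospectral graphs and let $H$ be any connected regular graph. Then: 1. $G_1\veebar H$ and $G_2\veebar H$ are $\epsilon$-cospectral; 2. if $H$ has at least one edge (so that the graphs below are connected), $H\veebar G_1$ and $H\veebar G_2$ are $\epsilon$-cospectral.
   Context: All graphs are finite, simple and undirected. The subdivision graph $S(G)$ of a graph $G$ is obtained from $G$ by subdividing each edge with one new vertex; $I(G)$ is the set of these new vertices, so $V(S(G))=V(G)\cup I(G)$. For vertex-disjoint graphs $G_1,G_2$, the subdivision-edge join $G_1\veebar G_2$ is obtained from $S(G_1)$ and $G_2$ by joining each vertex of $I(G_1)$ to every vertex of $V(G_2)$. For a connected graph $G$ with distance function $d$, the eccentricity of a vertex $v$ is $e(v)=\max\{d(v,u):u\in V(G)\}$. The eccentricity matrix $\epsilon(G)$ is the symmetric matrix indexed by $V(G)$ with $(u,v)$ entry $d(u,v)$ if $d(u,v)=\min\{e(u),e(v)\}$, and $0$ otherwise. The $\epsilon$-spectrum of $G$ is the multiset of eigenvalues of $\epsilon(G)$. Two graphs are cospectral if they are non-isomorphic, have the same order, and their adjacency matrices have the same spectrum (with multiplicities). Two connected graphs are $\epsilon$-cospectral if they are non-isomorphic, have the same order, and have the same $\epsilon$-spectrum. *)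

theory Defs
  imports
    "Graph_Theory.Graph_Theory"
    "Jordan_Normal_Form.Char_Poly"
    "HOL-Computational_Algebra.Polynomial"
begin

(* A finite simple undirected graph is a Graph_Theory pair_graph: a finite, loop-free, symmetric
   set of arcs without parallel arcs, so each undirected edge uv is stored as both arcs (u,v) and
   (v,u).  The library's "connected" requires a nonempty vertex set. *)

definition graph_edges :: "'a pair_pre_digraph \<Rightarrow> 'a set set" where
  "graph_edges G = (\<lambda>(u, v). {u, v}) ` parcs G"

definition regular_graph :: "'a pair_pre_digraph \<Rightarrow> bool" where
  "regular_graph G \<longleftrightarrow> (\<exists>r. \<forall>v \<in> pverts G. out_degree G v = r)"

definition subdivision_graph :: "'a pair_pre_digraph \<Rightarrow> ('a + 'a set) pair_pre_digraph" where
  "subdivision_graph G = \<lparr>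
     pverts = Inl ` pverts G \<union> Inr ` graph_edges G,
     parcs = {(Inl v, Inr e) | v e. e \<in> graph_edges G \<and> v \<in> e}
           \<union> {(Inr e, Inl v) | v e. e \<in> graph_edges G \<and> v \<in> e} \<rparr>"

definition subdivision_vertices :: "'a pair_pre_digraph \<Rightarrow> ('a + 'a set) set" where
  "subdivision_vertices G = Inr ` graph_edges G"

(* The outer sum type makes the two vertex sets disjoint, also when G and H share vertices. *)
definition subdivision_edge_join ::
  "'a pair_pre_digraph \<Rightarrow> 'b pair_pre_digraph \<Rightarrow> (('a + 'a set) + 'b) pair_pre_digraph" where
  "subdivision_edge_join G H = \<lparr>
     pverts = Inl ` pverts (subdivision_graph G) \<union> Inr ` pverts H,
     parcs = map_prod Inl Inl ` parcs (subdivision_graph G)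
           \<union> map_prod Inr Inr ` parcs H
           \<union> {(Inl x, Inr y) | x y. x \<in> subdivision_vertices G \<and> y \<in> pverts H}
           \<union> {(Inr y, Inl x) | x y. x \<in> subdivision_vertices G \<and> y \<in> pverts H} \<rparr>"

definition graph_dist :: "'a pair_pre_digraph \<Rightarrow> 'a \<Rightarrow> 'a \<Rightarrow> nat" where
  "graph_dist G u v = (LEAST n. \<exists>p. pre_digraph.awalk G u p v \<and> length p = n)"

definition eccentricity :: "'a pair_pre_digraph \<Rightarrow> 'a \<Rightarrow> nat" where
  "eccentricity G v = Max ((\<lambda>u. graph_dist G v u) ` pverts G)"

definition adjacency_entry :: "'a pair_pre_digraph \<Rightarrow> 'a \<Rightarrow> 'a \<Rightarrow> real" where
  "adjacency_entry G u v = (if (u, v) \<in> parcs G then 1 else 0)"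

definition eccentricity_entry :: "'a pair_pre_digraph \<Rightarrow> 'a \<Rightarrow> 'a \<Rightarrow> real" where
  "eccentricity_entry G u v =
     (if graph_dist G u v = min (eccentricity G u) (eccentricity G v)
      then real (graph_dist G u v) else 0)"

definition mat_of_enum :: "'a list \<Rightarrow> ('a \<Rightarrow> 'a \<Rightarrow> real) \<Rightarrow> complex mat" where
  "mat_of_enum vs f =
     mat (length vs) (length vs) (\<lambda>(i, j). complex_of_real (f (vs ! i) (vs ! j)))"

(* The multiset of eigenvalues, with algebraic multiplicity, of the matrix with entries f u v
   (u, v in V).  By spectrum_on_eq below the choice of the enumeration of V is irrelevant. *)
definition spectrum_on :: "'a set \<Rightarrow> ('a \<Rightarrow> 'a \<Rightarrow> real) \<Rightarrow> complex multiset" where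
  "spectrum_on V f =
     proots (char_poly (mat_of_enum (SOME vs. distinct vs \<and> set vs = V) f))"

definition adjacency_spectrum :: "'a pair_pre_digraph \<Rightarrow> complex multiset" where
  "adjacency_spectrum G = spectrum_on (pverts G) (adjacency_entry G)"

definition eccentricity_spectrum :: "'a pair_pre_digraph \<Rightarrow> complex multiset" where
  "eccentricity_spectrum G = spectrum_on (pverts G) (eccentricity_entry G)"

definition cospectral :: "'a pair_pre_digraph \<Rightarrow> 'b pair_pre_digraph \<Rightarrow> bool" where
  "cospectral G H \<longleftrightarrow> pair_graph G \<and> pair_graph H
     \<and> \<not> digraph_iso (with_proj G) (with_proj H)
     \<and> card (pverts G) = card (pverts H)
     \<and> adjacency_spectrum G = adjacency_spectrum H"

definition eccentricity_cospectral :: "'a pair_pre_digraph \<Rightarrow> 'b pair_pre_digraph \<Rightarrow> bool" where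
  "eccentricity_cospectral G H \<longleftrightarrow> pair_graph G \<and> pair_graph H
     \<and> Digraph_Component.connected G \<and> Digraph_Component.connected H
     \<and> \<not> digraph_iso (with_proj G) (with_proj H)
     \<and> card (pverts G) = card (pverts H)
     \<and> eccentricity_spectrum G = eccentricity_spectrum H"

lemma mat_of_enum_similar:
  assumes "distinct vs" "distinct ws" "set vs = set ws"
  shows "similar_mat (mat_of_enum vs f) (mat_of_enum ws f)"
proof -
  define n where "n = length vs"
  have n': "length ws = n" using assms by (metis distinct_card n_def)
  define P :: "complex mat" where "P = mat n n (\<lambda>(i, j). if vs ! i = ws ! j then 1 else 0)"
  define Q :: "complex mat" where "Q = mat n n (\<lambda>(i, j). if ws ! i = vs ! j then 1 else 0)"
  have key: "(\<Sum>k<n. (if a = xs ! k then 1 else 0) * g (xs ! k)) = g a"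
    if "distinct xs" "length xs = n" "a \<in> set xs" for xs and a :: 'a and g :: "'a \<Rightarrow> complex"
  proof -
    have "(\<Sum>k<n. (if a = xs ! k then 1 else 0) * g (xs ! k))
        = (\<Sum>x\<in>set xs. (if a = x then 1 else 0) * g x)"
      by (rule sum.reindex_bij_betw) (use that bij_betw_nth in blast)
    also have "\<dots> = (\<Sum>x\<in>set xs. if a = x then g x else 0)" by (intro sum.cong) auto
    also have "\<dots> = g a" using that by simp
    finally show ?thesis .
  qed
  have vin: "vs ! i \<in> set ws" "vs ! i \<in> set vs" if "i < n" for i
    using that nth_mem[of i vs] by (simp_all add: n_def assms(3))
  have win: "ws ! i \<in> set ws" "ws ! i \<in> set vs" if "i < n" for i
    using that nth_mem[of i ws] by (simp_all add: n' assms(3))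
  have PQ: "P * Q = 1\<^sub>m n"
  proof (rule eq_matI)
    fix i j assume ij: "i < dim_row (1\<^sub>m n :: complex mat)" "j < dim_col (1\<^sub>m n :: complex mat)"
    have "(P * Q) $$ (i, j) = (\<Sum>k<n. (if vs ! i = ws ! k then 1 else 0) * (\<lambda>x. if x = vs ! j then 1 else 0) (ws ! k))"
      using ij by (simp add: P_def Q_def scalar_prod_def lessThan_atLeast0)
    also have "\<dots> = (if vs ! i = vs ! j then 1 else 0)"
      using key[OF assms(2) n' vin(1), of i "\<lambda>x. if x = vs ! j then 1 else 0"] ij by simp
    finally show "(P * Q) $$ (i, j) = 1\<^sub>m n $$ (i, j)"
      using ij assms(1) by (simp add: nth_eq_iff_index_eq n_def)
  qed (auto simp: P_def Q_def)
  have QP: "Q * P = 1\<^sub>m n"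
    by (rule mat_mult_left_right_inverse[OF _ _ PQ]) (auto simp: P_def Q_def)
  have AP: "mat_of_enum vs f * P = P * mat_of_enum ws f"
  proof (rule eq_matI)
    fix i j assume ij: "i < dim_row (P * mat_of_enum ws f)" "j < dim_col (P * mat_of_enum ws f)"
    then have ij': "i < n" "j < n" by (auto simp: P_def mat_of_enum_def n')
    have "(mat_of_enum vs f * P) $$ (i, j)
        = (\<Sum>k<n. (if ws ! j = vs ! k then 1 else 0) * (\<lambda>x. complex_of_real (f (vs ! i) x)) (vs ! k))"
      using ij' by (simp add: P_def mat_of_enum_def n_def[symmetric] scalar_prod_def lessThan_atLeast0)
        (auto intro!: sum.cong)
    also have "\<dots> = complex_of_real (f (vs ! i) (ws ! j))"
      using key[OF assms(1) n_def[symmetric] win(2)[OF ij'(2)], of "\<lambda>x. complex_of_real (f (vs ! i) x)"] by simp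
    finally have 1: "(mat_of_enum vs f * P) $$ (i, j) = complex_of_real (f (vs ! i) (ws ! j))" .
    have "(P * mat_of_enum ws f) $$ (i, j)
        = (\<Sum>k<n. (if vs ! i = ws ! k then 1 else 0) * (\<lambda>x. complex_of_real (f x (ws ! j))) (ws ! k))"
      using ij' by (simp add: P_def mat_of_enum_def n' scalar_prod_def lessThan_atLeast0)
    also have "\<dots> = complex_of_real (f (vs ! i) (ws ! j))"
      using key[OF assms(2) n' vin(1)[OF ij'(1)], of "\<lambda>x. complex_of_real (f x (ws ! j))"] by simp
    finally show "(mat_of_enum vs f * P) $$ (i, j) = (P * mat_of_enum ws f) $$ (i, j)"
      using 1 by simp
  qed (auto simp: P_def mat_of_enum_def n_def n')
  have carr: "P \<in> carrier_mat n n" "Q \<in> carrier_mat n n" "mat_of_enum vs f \<in> carrier_mat n n"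
    "mat_of_enum ws f \<in> carrier_mat n n"
    by (auto simp: P_def Q_def mat_of_enum_def n_def n')
  have "mat_of_enum vs f = mat_of_enum vs f * (P * Q)"
    unfolding PQ by (rule right_mult_one_mat[OF carr(3), symmetric])
  also have "\<dots> = mat_of_enum vs f * P * Q"
    by (rule assoc_mult_mat[symmetric, OF carr(3,1,2)])
  also have "\<dots> = P * mat_of_enum ws f * Q" by (simp only: AP)
  finally have "mat_of_enum vs f = P * mat_of_enum ws f * Q" .
  then have "similar_mat_wit (mat_of_enum vs f) (mat_of_enum ws f) P Q"
    by (rule similar_mat_witI[OF PQ QP _ carr(3,4,1,2)])
  then show ?thesis unfolding similar_mat_def by blast
qed

lemma spectrum_on_eq:
  assumes "distinct vs" "set vs = V"
  shows "spectrum_on V f = proots (char_poly (mat_of_enum vs f))"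
proof -
  let ?ws = "SOME vs. distinct vs \<and> set vs = V"
  have "distinct ?ws \<and> set ?ws = V" by (rule someI[of _ vs]) (use assms in simp)
  then have "similar_mat (mat_of_enum ?ws f) (mat_of_enum vs f)"
    using assms by (intro mat_of_enum_similar) auto
  then show ?thesis by (simp add: spectrum_on_def char_poly_similar)
qed

(* graph_dist is the shortest-path length of Graph_Theory for unit weights. *)
lemma graph_dist_eq_shortest_path:
  assumes "pair_graph G" "u \<rightarrow>\<^sup>*\<^bsub>with_proj G\<^esub> v"
  shows "wf_digraph.\<mu> G (\<lambda>_. 1) u v = ereal (real (graph_dist G u v))"
proof -
  interpret pair_graph G by fact
  have cost: "awalk_cost (\<lambda>_. 1) p = real (length p)" for p
    by (simp add: awalk_cost_def sum_list_triv)
  have "\<exists>n p. awalk u p v \<and> length p = n" using assms(2) by (simp add: reachable_awalk)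
  then have "\<exists>p. awalk u p v \<and> length p = graph_dist G u v"
    unfolding graph_dist_def by (rule LeastI_ex)
  then obtain p where p: "awalk u p v" "length p = graph_dist G u v" by blast
  show ?thesis
  proof (rule antisym)
    show "\<mu> (\<lambda>_. 1) u v \<le> ereal (real (graph_dist G u v))"
      using min_cost_le_walk_cost[OF p(1), of "\<lambda>_. 1"] p(2) by (simp add: cost)
    show "ereal (real (graph_dist G u v)) \<le> \<mu> (\<lambda>_. 1) u v"
      unfolding \<mu>_def cost graph_dist_def by (auto intro!: INF_greatest Least_le)
  qed
qed

lemma pair_graph_subdivision_edge_join:
  assumes "pair_graph G" "pair_graph H"
  shows "pair_graph (subdivision_edge_join G H)"
proof -
  interpret G: pair_graph G by fact
  interpret H: pair_graph H by fact
  have E: "finite (graph_edges G)" "\<And>e v. e \<in> graph_edges G \<Longrightarrow> v \<in> e \<Longrightarrow> v \<in> pverts G"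
    using G.in_arcsD1 G.in_arcsD2 G.pair_finite_arcs by (auto simp: graph_edges_def)
  let ?J = "subdivision_edge_join G H"
  have V: "finite (pverts ?J)"
    using E G.pair_finite_verts H.pair_finite_verts
    by (simp add: subdivision_edge_join_def subdivision_graph_def)
  have A: "parcs ?J \<subseteq> pverts ?J \<times> pverts ?J"
    using E H.in_arcsD1 H.in_arcsD2
    by (fastforce simp: subdivision_edge_join_def subdivision_graph_def subdivision_vertices_def)
  show ?thesis
  proof
    show "finite (parcs ?J)" using A V by (meson finite_SigmaI finite_subset)
    have "sym (parcs H)" using H.sym_arcs by (simp add: symmetric_def)
    then show "symmetric ?J"
      unfolding symmetric_def sym_def
      by (auto simp: subdivision_edge_join_def subdivision_graph_def)
  next
    fix e assume "e \<in> parcs ?J"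
    then show "fst e \<noteq> snd e"
      using H.pair_no_loops by (auto simp: subdivision_edge_join_def subdivision_graph_def)
  qed (use A V in auto)
qed

end

theory Submission
  imports Defs
begin

text \<open>
  Elimination in \<open>x I - \<epsilon>\<close> reduces the characteristic polynomial to a block
  \<open>N = a I + b A + c J\<close> indexed by the vertices of \<open>G\<^sub>i\<close>, where \<open>A\<close> is the adjacency matrix of
  \<open>G\<^sub>i\<close> and \<open>J\<close> the all-ones matrix. In the first join one eliminates the subdivision vertices
  first, where the block of \<open>x I - \<epsilon>\<close> is \<open>x I\<close>; the all-ones matrix minus the incidence matrix \<open>R\<close>
  then contributes its Gram matrix, which is again of this shape because \<open>R R\<^sup>T = r I + A\<close>.
  The entries that couple \<open>N\<close> to any other vertex are constant along the vertices of \<open>G\<^sub>i\<close>, and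
  \<open>N\<close> has constant row sums, so eliminating \<open>N\<close> changes the remaining block by a quantity that
  depends only on the degree and the number of vertices of \<open>G\<^sub>i\<close>. Finally \<open>det N\<close> depends only on
  these two numbers and on the characteristic polynomial of \<open>A\<close>, and the degree is the largest
  real eigenvalue of \<open>A\<close>.

  For non-isomorphism, the vertices of \<open>H\<close> are characterised in \<open>G \<veebar> H\<close> by a first-order property
  of the graph, hence an isomorphism of joins restricts to one of the factors \<open>G\<^sub>1, G\<^sub>2\<close>.
\<close>

section \<open>Determinants and spectra of matrices indexed by finite sets\<close>

text \<open>Indexing by a set instead of by positions allows a determinant to be split along
  disjoint classes of vertices and transported along bijections. The enumeration chosen is
  immaterial by \<open>det_on_eq\<close>.\<close>

definition det_on :: "'a set \<Rightarrow> ('a \<Rightarrow> 'a \<Rightarrow> real) \<Rightarrow> complex" where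
  "det_on V f = det (mat_of_enum (SOME vs. distinct vs \<and> set vs = V) f)"

lemma det_on_eq:
  assumes "distinct vs" "set vs = V"
  shows "det_on V f = det (mat_of_enum vs f)"
proof -
  let ?ws = "SOME vs. distinct vs \<and> set vs = V"
  have "distinct ?ws \<and> set ?ws = V"
    by (rule someI[of _ vs]) (use assms in simp)
  then have "similar_mat (mat_of_enum ?ws f) (mat_of_enum vs f)"
    using assms by (intro mat_of_enum_similar) auto
  then show ?thesis
    by (simp add: det_on_def det_similar)
qed

lemma mat_of_enum_carrier [simp]: "mat_of_enum vs f \<in> carrier_mat (length vs) (length vs)"
  by (simp add: mat_of_enum_def)

lemma det_on_cong:
  assumes "finite V" "\<And>u v. u \<in> V \<Longrightarrow> v \<in> V \<Longrightarrow> f u v = g u v"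
  shows "det_on V f = det_on V g"
proof -
  obtain vs where vs: "distinct vs" "set vs = V"
    using finite_distinct_list[OF assms(1)] by blast
  have "mat_of_enum vs f = mat_of_enum vs g"
    using vs assms(2) by (auto simp: mat_of_enum_def intro!: eq_matI)
  then show ?thesis
    by (simp add: det_on_eq[OF vs])
qed

lemma det_on_mult:
  assumes "finite V"
  shows "det_on V (\<lambda>u v. \<Sum>w\<in>V. f u w * g w v) = det_on V f * det_on V g"
proof -
  obtain vs where vs: "distinct vs" "set vs = V"
    using finite_distinct_list[OF assms] by blast
  have "mat_of_enum vs f * mat_of_enum vs g = mat_of_enum vs (\<lambda>u v. \<Sum>w\<in>V. f u w * g w v)"
  proof (rule eq_matI)
    fix i j
    assume "i < dim_row (mat_of_enum vs (\<lambda>u v. \<Sum>w\<in>V. f u w * g w v))"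
      "j < dim_col (mat_of_enum vs (\<lambda>u v. \<Sum>w\<in>V. f u w * g w v))"
    then have ij: "i < length vs" "j < length vs"
      by (simp_all add: mat_of_enum_def)
    have "(\<Sum>k<length vs. f (vs ! i) (vs ! k) * g (vs ! k) (vs ! j))
        = (\<Sum>w\<in>V. f (vs ! i) w * g w (vs ! j))"
      by (rule sum.reindex_bij_betw) (use vs bij_betw_nth in blast)
    from arg_cong[OF this, of complex_of_real]
    show "(mat_of_enum vs f * mat_of_enum vs g) $$ (i, j)
        = mat_of_enum vs (\<lambda>u v. \<Sum>w\<in>V. f u w * g w v) $$ (i, j)"
      using ij by (simp add: mat_of_enum_def scalar_prod_def lessThan_atLeast0)
  qed (simp_all add: mat_of_enum_def)
  then show ?thesis
    using det_mult[OF mat_of_enum_carrier[of vs f] mat_of_enum_carrier[of vs g]]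
    by (simp add: det_on_eq[OF vs])
qed

text \<open>Listing \<open>V\<close> before \<open>W\<close> gives a four-block matrix whose lower
  left block is zero.\<close>

lemma det_on_block_triangular:
  assumes "finite V" "finite W" "V \<inter> W = {}"
    and zero: "\<And>u v. u \<in> W \<Longrightarrow> v \<in> V \<Longrightarrow> f u v = 0"
  shows "det_on (V \<union> W) f = det_on V f * det_on W f"
proof -
  obtain vs where vs: "distinct vs" "set vs = V"
    using finite_distinct_list[OF assms(1)] by blast
  obtain ws where ws: "distinct ws" "set ws = W"
    using finite_distinct_list[OF assms(2)] by blast
  let ?n = "length vs" and ?m = "length ws"
  let ?B = "mat ?n ?m (\<lambda>(i, j). complex_of_real (f (vs ! i) (ws ! j)))"
  have "mat_of_enum (vs @ ws) f
      = four_block_mat (mat_of_enum vs f) ?B (0\<^sub>m ?m ?n) (mat_of_enum ws f)"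
  proof (rule eq_matI)
    fix i j
    assume "i < dim_row (four_block_mat (mat_of_enum vs f) ?B (0\<^sub>m ?m ?n) (mat_of_enum ws f))"
      "j < dim_col (four_block_mat (mat_of_enum vs f) ?B (0\<^sub>m ?m ?n) (mat_of_enum ws f))"
    then have "i < ?n + ?m" "j < ?n + ?m"
      by (simp_all add: mat_of_enum_def)
    moreover have "f (ws ! (i - ?n)) (vs ! j) = 0" if "\<not> i < ?n" "i < ?n + ?m" "j < ?n"
      using that vs ws by (intro zero) auto
    ultimately show "mat_of_enum (vs @ ws) f $$ (i, j)
        = four_block_mat (mat_of_enum vs f) ?B (0\<^sub>m ?m ?n) (mat_of_enum ws f) $$ (i, j)"
      by (auto simp: mat_of_enum_def nth_append)
  qed (simp_all add: mat_of_enum_def)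
  moreover have "det_on (V \<union> W) f = det (mat_of_enum (vs @ ws) f)"
    using vs ws assms(3) by (intro det_on_eq) auto
  moreover have "det (four_block_mat (mat_of_enum vs f) ?B (0\<^sub>m ?m ?n) (mat_of_enum ws f))
      = det (mat_of_enum vs f) * det (mat_of_enum ws f)"
    by (rule det_four_block_mat_lower_left_zero[of _ ?n _ ?m]) auto
  ultimately show ?thesis
    by (simp add: det_on_eq[OF vs] det_on_eq[OF ws])
qed

lemma det_on_reindex:
  assumes "finite V" "inj_on \<phi> V"
  shows "det_on (\<phi> ` V) f = det_on V (\<lambda>u v. f (\<phi> u) (\<phi> v))"
proof -
  obtain vs where vs: "distinct vs" "set vs = V"
    using finite_distinct_list[OF assms(1)] by blast
  have "mat_of_enum (map \<phi> vs) f = mat_of_enum vs (\<lambda>u v. f (\<phi> u) (\<phi> v))"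
    by (auto simp: mat_of_enum_def intro!: eq_matI)
  moreover have "det_on (\<phi> ` V) f = det (mat_of_enum (map \<phi> vs) f)"
    using vs assms by (intro det_on_eq) (auto simp: distinct_map)
  ultimately show ?thesis
    by (simp add: det_on_eq[OF vs])
qed

lemma det_on_scalar:
  assumes "finite V"
  shows "det_on V (\<lambda>u v. if u = v then c else 0) = complex_of_real c ^ card V"
proof -
  obtain vs where vs: "distinct vs" "set vs = V"
    using finite_distinct_list[OF assms] by blast
  have "mat_of_enum vs (\<lambda>u v. if u = v then c else 0) = complex_of_real c \<cdot>\<^sub>m 1\<^sub>m (length vs)"
    using vs by (auto simp: mat_of_enum_def nth_eq_iff_index_eq intro!: eq_matI)
  then show ?thesis
    using vs by (simp add: det_on_eq[OF vs] distinct_card[symmetric])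
qed

lemma det_on_smult:
  assumes "finite V"
  shows "det_on V (\<lambda>u v. c * f u v) = complex_of_real c ^ card V * det_on V f"
proof -
  obtain vs where vs: "distinct vs" "set vs = V"
    using finite_distinct_list[OF assms] by blast
  have "mat_of_enum vs (\<lambda>u v. c * f u v) = complex_of_real c \<cdot>\<^sub>m mat_of_enum vs f"
    by (auto simp: mat_of_enum_def intro!: eq_matI)
  then show ?thesis
    using vs by (simp add: det_on_eq[OF vs] distinct_card[symmetric] mat_of_enum_def)
qed

text \<open>A singular matrix has a nonzero kernel vector, stated here as a function on
  \<open>V\<close>. This is how real eigenvalues are detected below.\<close>

lemma det_on_eq_0_iff:
  assumes "finite V"
  shows "det_on V f = 0 \<longleftrightarrow>
    (\<exists>x. (\<exists>v\<in>V. x v \<noteq> 0) \<and> (\<forall>u\<in>V. (\<Sum>v\<in>V. complex_of_real (f u v) * x v) = 0))"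
    (is "_ \<longleftrightarrow> ?R")
proof -
  obtain vs where vs: "distinct vs" "set vs = V"
    using finite_distinct_list[OF assms] by blast
  let ?n = "length vs" and ?M = "mat_of_enum vs f"
  have sum_nth: "(\<Sum>k<?n. h (vs ! k)) = (\<Sum>w\<in>V. h w)" for h :: "'a \<Rightarrow> complex"
    by (rule sum.reindex_bij_betw) (use vs bij_betw_nth in blast)
  have "det_on V f = 0 \<longleftrightarrow> (\<exists>y. y \<in> carrier_vec ?n \<and> y \<noteq> 0\<^sub>v ?n \<and> ?M *\<^sub>v y = 0\<^sub>v ?n)"
    by (simp add: det_on_eq[OF vs] det_0_iff_vec_prod_zero[of _ ?n])
  also have "\<dots> \<longleftrightarrow> ?R"
  proof
    assume "\<exists>y. y \<in> carrier_vec ?n \<and> y \<noteq> 0\<^sub>v ?n \<and> ?M *\<^sub>v y = 0\<^sub>v ?n"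
    then obtain y where y: "y \<in> carrier_vec ?n" "y \<noteq> 0\<^sub>v ?n" "?M *\<^sub>v y = 0\<^sub>v ?n"
      by blast
    \<comment> \<open>The list is distinct, so for \<open>v\<close> in \<open>V\<close> the
      described position is unique; values of \<open>x\<close> outside \<open>V\<close> never enter
      the sums.\<close>
    define x where "x v = y $ (THE i. i < ?n \<and> vs ! i = v)" for v
    have x: "x (vs ! i) = y $ i" if "i < ?n" for i
    proof -
      have "(THE j. j < ?n \<and> vs ! j = vs ! i) = i"
        using that vs(1) by (intro the_equality) (auto simp: nth_eq_iff_index_eq)
      then show ?thesis
        by (simp add: x_def)
    qed
    obtain i where i: "i < ?n" "y $ i \<noteq> 0"
      using y(1,2) by (metis carrier_vecD eq_vecI index_zero_vec(1) index_zero_vec(2))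
    have "(\<Sum>v\<in>V. complex_of_real (f u v) * x v) = 0" if u: "u \<in> V" for u
    proof -
      obtain j where j: "j < ?n" "vs ! j = u"
        using u vs by (metis in_set_conv_nth)
      have "(\<Sum>v\<in>V. complex_of_real (f u v) * x v) = (?M *\<^sub>v y) $ j"
        unfolding sum_nth[symmetric] using j y(1) x
        by (simp add: mat_of_enum_def scalar_prod_def lessThan_atLeast0)
      then show ?thesis
        using y(3) j by simp
    qed
    moreover have "vs ! i \<in> V" "x (vs ! i) \<noteq> 0"
      using i vs x by auto
    ultimately show ?R
      by blast
  next
    assume ?R
    then obtain x where x: "\<exists>v\<in>V. x v \<noteq> 0"
      "\<And>u. u \<in> V \<Longrightarrow> (\<Sum>v\<in>V. complex_of_real (f u v) * x v) = 0"
      by blast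
    define y where "y = vec ?n (\<lambda>i. x (vs ! i))"
    obtain i where i: "i < ?n" "x (vs ! i) \<noteq> 0"
      using x(1) vs by (metis in_set_conv_nth)
    have "y $ i = x (vs ! i)"
      using i by (simp add: y_def)
    then have "y \<noteq> 0\<^sub>v ?n"
      using i by auto
    moreover have "?M *\<^sub>v y = 0\<^sub>v ?n"
    proof (rule eq_vecI)
      fix j
      assume "j < dim_vec (0\<^sub>v ?n :: complex vec)"
      then have j: "j < ?n"
        by simp
      then have "(?M *\<^sub>v y) $ j = (\<Sum>v\<in>V. complex_of_real (f (vs ! j) v) * x v)"
        unfolding sum_nth[symmetric]
        by (simp add: mat_of_enum_def scalar_prod_def y_def lessThan_atLeast0)
      also have "\<dots> = 0"
        using j vs by (intro x(2)) auto
      finally show "(?M *\<^sub>v y) $ j = 0\<^sub>v ?n $ j"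
        using j by simp
    qed (simp add: mat_of_enum_def)
    ultimately show "\<exists>y. y \<in> carrier_vec ?n \<and> y \<noteq> 0\<^sub>v ?n \<and> ?M *\<^sub>v y = 0\<^sub>v ?n"
      by (intro exI[of _ y]) (simp add: y_def)
  qed
  finally show ?thesis .
qed

section \<open>Spectra and values of characteristic polynomials at real points\<close>

lemma poly_char_poly_mat_of_enum:
  assumes "distinct vs" "set vs = V"
  shows "poly (char_poly (mat_of_enum vs f)) (complex_of_real x)
    = det_on V (\<lambda>u v. (if u = v then x else 0) - f u v)"
proof -
  have "- (char_matrix (mat_of_enum vs f) (complex_of_real x))
      = mat_of_enum vs (\<lambda>u v. (if u = v then x else 0) - f u v)"
    using assms(1) unfolding char_matrix_def mat_of_enum_def
    by (auto intro!: eq_matI simp: nth_eq_iff_index_eq)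
  then show ?thesis
    by (simp add: char_poly_matrix[OF mat_of_enum_carrier] det_on_eq[OF assms])
qed

text \<open>Over the complex numbers the characteristic polynomial splits into monic linear factors,
  so the multiset of its roots determines it. Hence equal spectra give equal characteristic
  polynomials.\<close>

lemma char_poly_eq_prod_proots:
  fixes M :: "complex mat"
  assumes "M \<in> carrier_mat n n"
  shows "char_poly M = (\<Prod>a\<in>#proots (char_poly M). [:- a, 1:])"
proof -
  obtain as where as: "char_poly M = (\<Prod>a\<leftarrow>as. [:- a, 1:])"
    using char_poly_factorized[OF assms] by blast
  have "proots (\<Prod>a\<leftarrow>as. [:- a, 1:]) = mset as"
  proof (induction as)
    case (Cons a as)
    have "(\<Prod>a\<leftarrow>as. [:- a, 1:]) \<noteq> 0"
      by (auto simp: prod_list_zero_iff)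
    then show ?case
      using Cons by (simp add: proots_mult del: mult_pCons_left)
  qed simp
  then have "proots (char_poly M) = mset as"
    by (simp only: as)
  moreover have "(\<Prod>a\<in>#mset as. [:- a, 1:]) = (\<Prod>a\<leftarrow>as. [:- a, 1:])"
    by (metis mset_map prod_mset_prod_list)
  ultimately show ?thesis
    using as by (simp only:)
qed

lemma det_on_char_eq_of_spectrum_on_eq:
  assumes "finite V" "finite W" "spectrum_on V f = spectrum_on W g"
  shows "det_on V (\<lambda>u v. (if u = v then x else 0) - f u v)
    = det_on W (\<lambda>u v. (if u = v then x else 0) - g u v)"
proof -
  obtain vs where vs: "distinct vs" "set vs = V"
    using finite_distinct_list[OF assms(1)] by blast
  obtain ws where ws: "distinct ws" "set ws = W"
    using finite_distinct_list[OF assms(2)] by blast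
  have "char_poly (mat_of_enum vs f) = char_poly (mat_of_enum ws g)"
    using assms(3) unfolding spectrum_on_eq[OF vs] spectrum_on_eq[OF ws]
    using char_poly_eq_prod_proots[OF mat_of_enum_carrier[of vs f]]
      char_poly_eq_prod_proots[OF mat_of_enum_carrier[of ws g]] by simp
  then have "poly (char_poly (mat_of_enum vs f)) (complex_of_real x)
      = poly (char_poly (mat_of_enum ws g)) (complex_of_real x)"
    by (simp only:)
  then show ?thesis
    by (simp only: poly_char_poly_mat_of_enum[OF vs] poly_char_poly_mat_of_enum[OF ws])
qed

text \<open>Two polynomials that agree at infinitely many real points coincide. The finite set
  \<open>X\<close> absorbs the values of \<open>x\<close> at which an elimination would divide by
  zero.\<close>

lemma spectrum_on_eqI:
  assumes "finite V" "finite W" "finite X"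
    and eq: "\<And>x. x \<notin> X \<Longrightarrow> det_on V (\<lambda>u v. (if u = v then x else 0) - f u v)
      = det_on W (\<lambda>u v. (if u = v then x else 0) - g u v)"
  shows "spectrum_on V f = spectrum_on W g"
proof -
  obtain vs where vs: "distinct vs" "set vs = V"
    using finite_distinct_list[OF assms(1)] by blast
  obtain ws where ws: "distinct ws" "set ws = W"
    using finite_distinct_list[OF assms(2)] by blast
  let ?p = "char_poly (mat_of_enum vs f) - char_poly (mat_of_enum ws g)"
  have "complex_of_real ` (- X) \<subseteq> {z. poly ?p z = 0}"
    using eq by (auto simp: poly_char_poly_mat_of_enum vs ws)
  moreover have "infinite (complex_of_real ` (- X))"
    using assms(3) finite_imageD[of complex_of_real "- X"]
    by (auto simp: inj_on_def finite_compl infinite_UNIV_char_0)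
  ultimately have "?p = 0"
    using poly_roots_finite finite_subset by blast
  then show ?thesis
    by (simp add: spectrum_on_eq[OF vs] spectrum_on_eq[OF ws])
qed

section \<open>Schur complements and matrices with constant row sums\<close>

text \<open>The Schur complement formula. Here \<open>g\<close> stands for the inverse of the
  \<open>W\<close> block times the block with rows \<open>W\<close> and columns \<open>V\<close>;
  describing it as a solution of a linear system avoids inverse matrices, and in the applications a
  solution is visible at once.\<close>

lemma det_on_eliminate:
  assumes "finite V" "finite W" "V \<inter> W = {}"
    and g: "\<And>w v. w \<in> W \<Longrightarrow> v \<in> V \<Longrightarrow> (\<Sum>w'\<in>W. f w w' * g w' v) = f w v"
  shows "det_on (V \<union> W) f = det_on V (\<lambda>u v. f u v - (\<Sum>w\<in>W. f u w * g w v)) * det_on W f"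
proof -
  \<comment> \<open>Right multiplication by \<open>L\<close> subtracts from each column
    \<open>v\<close> in \<open>V\<close> the columns \<open>w\<close> in \<open>W\<close> with
    weights \<open>g w v\<close>. By the choice of \<open>g\<close> this clears the block with rows
    \<open>W\<close> and columns \<open>V\<close>.\<close>
  define L where "L u v = (if u = v then 1 else if u \<in> W \<and> v \<in> V then - g u v else 0)" for u v
  define h where "h u v = (\<Sum>w\<in>V \<union> W. f u w * L w v)" for u v
  have dL: "det_on (V \<union> W) L = 1"
  proof -
    have "det_on S L = det_on S (\<lambda>u v. if u = v then 1 else 0)"
      if "finite S" "S \<inter> V = {} \<or> S \<inter> W = {}" for S
      using that by (intro det_on_cong) (auto simp: L_def)
    then have "det_on V L = 1" "det_on W L = 1"
      using assms by (auto simp: det_on_scalar)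
    \<comment> \<open>The zero block of \<open>L\<close> has rows in \<open>V\<close> and columns in
      \<open>W\<close>, so triangularity requires \<open>W\<close> to come first.\<close>
    moreover have "det_on (W \<union> V) L = det_on W L * det_on V L"
      using assms by (intro det_on_block_triangular) (auto simp: L_def)
    ultimately show ?thesis
      by (simp add: Un_commute)
  qed
  have hV: "h u v = f u v - (\<Sum>w\<in>W. f u w * g w v)" if "v \<in> V" for u v
  proof -
    have "(\<Sum>w\<in>V. f u w * L w v) = (\<Sum>w\<in>V. if w = v then f u v else 0)"
      using assms(3) by (intro sum.cong) (auto simp: L_def)
    moreover have "(\<Sum>w\<in>W. f u w * L w v) = (\<Sum>w\<in>W. - (f u w * g w v))"
      using assms(3) that by (intro sum.cong) (auto simp: L_def)
    ultimately show ?thesis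
      using assms that by (simp add: h_def sum.union_disjoint sum_negf)
  qed
  have hW: "h u v = f u v" if "v \<in> W" for u v
  proof -
    have "h u v = (\<Sum>w\<in>V \<union> W. if w = v then f u v else 0)"
      using assms(3) that unfolding h_def by (intro sum.cong) (auto simp: L_def)
    then show ?thesis
      using assms that by simp
  qed
  have "det_on (V \<union> W) f = det_on (V \<union> W) h"
    using det_on_mult[of "V \<union> W" f L] assms dL by (simp add: h_def[abs_def])
  also have "\<dots> = det_on V h * det_on W h"
    using assms hV g by (intro det_on_block_triangular) auto
  also have "det_on V h = det_on V (\<lambda>u v. f u v - (\<Sum>w\<in>W. f u w * g w v))"
    using assms hV by (intro det_on_cong) auto
  also have "det_on W h = det_on W f"
    using assms hW by (intro det_on_cong) auto
  finally show ?thesis .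
qed

text \<open>If all row sums of \<open>f\<close> equal \<open>s\<close>, then \<open>f\<close> times the all-ones matrix is \<open>s\<close> times the
  all-ones matrix, so \<open>f + c J = f (I + (c / s) J)\<close>.\<close>

lemma det_on_add_const:
  assumes "finite V" "s \<noteq> 0" "\<And>u. u \<in> V \<Longrightarrow> (\<Sum>v\<in>V. f u v) = s"
  shows "det_on V (\<lambda>u v. f u v + c)
    = det_on V f * det_on V (\<lambda>u v. (if u = v then 1 else 0) + c / s)"
proof -
  have "(\<Sum>w\<in>V. f u w * ((if w = v then 1 else 0) + c / s)) = f u v + c"
    if "u \<in> V" "v \<in> V" for u v
  proof -
    have "(\<Sum>w\<in>V. f u w * ((if w = v then 1 else 0) + c / s))
        = (\<Sum>w\<in>V. if w = v then f u v else 0) + (\<Sum>w\<in>V. f u w) * (c / s)"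
      by (simp add: distrib_left sum.distrib sum_distrib_right sum_divide_distrib
          if_distrib[of "(*) _"] cong: if_cong)
    then show ?thesis
      using assms that by simp
  qed
  then show ?thesis
    using assms(1) by (subst det_on_mult[symmetric]) (auto intro: det_on_cong)
qed

text \<open>The matrix looks the same from every index, so any bijection between the index sets
  transports it; the value itself is never computed.\<close>

lemma det_on_one_plus_const:
  assumes "finite V" "finite W" "card V = card W"
  shows "det_on V (\<lambda>u v. (if u = v then 1 else 0) + c)
    = det_on W (\<lambda>u v. (if u = v then 1 else 0) + c)"
proof -
  obtain \<phi> where \<phi>: "bij_betw \<phi> V W"
    using assms finite_same_card_bij by blast
  then have "det_on W (\<lambda>u v. (if u = v then 1 else 0) + c)
      = det_on V (\<lambda>u v. (if \<phi> u = \<phi> v then 1 else 0) + c)"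
    using assms by (subst bij_betw_imp_surj_on[OF \<phi>, symmetric], subst det_on_reindex)
      (auto simp: bij_betw_def)
  also have "\<dots> = det_on V (\<lambda>u v. (if u = v then 1 else 0) + c)"
    using \<phi> assms by (intro det_on_cong) (auto simp: bij_betw_def inj_on_eq_iff)
  finally show ?thesis
    by simp
qed

text \<open>Factoring out \<open>- b\<close> turns the matrix into the characteristic matrix of
  \<open>f\<close> at \<open>- a / b\<close>.\<close>

lemma det_on_pencil:
  assumes "finite V" "b \<noteq> 0"
  shows "det_on V (\<lambda>u v. (if u = v then a else 0) + b * f u v)
    = complex_of_real (- b) ^ card V * det_on V (\<lambda>u v. (if u = v then - a / b else 0) - f u v)"
proof -
  have "(if u = v then a else 0) + b * f u v = - b * ((if u = v then - a / b else 0) - f u v)" for u v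
    using assms(2) by (simp add: right_diff_distrib)
  then show ?thesis
    by (simp only: det_on_smult[OF assms(1)])
qed

lemma det_on_pencil_add_const:
  assumes "finite V" "\<And>u. u \<in> V \<Longrightarrow> (\<Sum>v\<in>V. f u v) = r" "a + b * r \<noteq> 0"
  shows "det_on V (\<lambda>u v. (if u = v then a else 0) + b * f u v + c)
    = det_on V (\<lambda>u v. (if u = v then a else 0) + b * f u v)
      * det_on V (\<lambda>u v. (if u = v then 1 else 0) + c / (a + b * r))"
proof (rule det_on_add_const[OF assms(1,3)])
  fix u assume u: "u \<in> V"
  have "(\<Sum>v\<in>V. (if u = v then a else 0) + b * f u v)
      = (\<Sum>v\<in>V. if u = v then a else 0) + b * (\<Sum>v\<in>V. f u v)"
    by (simp only: sum.distrib sum_distrib_left)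
  then show "(\<Sum>v\<in>V. (if u = v then a else 0) + b * f u v) = a + b * r"
    using assms(1,2) u by simp
qed

text \<open>This makes precise that \<open>det N\<close> depends only on the order, the degree and
  the characteristic polynomial. The condition \<open>nz\<close> says that the row sums before
  adding \<open>c\<close> are nonzero, so that the constant term splits off as a separate
  factor.\<close>

lemma det_on_regular_eq:
  assumes fin: "finite V" "finite W" and card: "card V = card W"
    and char: "\<And>x. det_on V (\<lambda>u v. (if u = v then x else 0) - f u v)
      = det_on W (\<lambda>u v. (if u = v then x else 0) - g u v)"
    and f: "\<And>u. u \<in> V \<Longrightarrow> (\<Sum>v\<in>V. f u v) = r"
    and g: "\<And>u. u \<in> W \<Longrightarrow> (\<Sum>v\<in>W. g u v) = r"
    and nz: "a + b * r \<noteq> 0"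
  shows "det_on V (\<lambda>u v. (if u = v then a else 0) + b * f u v + c)
    = det_on W (\<lambda>u v. (if u = v then a else 0) + b * g u v + c)"
proof -
  have "det_on V (\<lambda>u v. (if u = v then a else 0) + b * f u v)
      = det_on W (\<lambda>u v. (if u = v then a else 0) + b * g u v)"
  \<comment> \<open>For \<open>b = 0\<close> the point \<open>- a / b\<close> is meaningless, but
    then the matrix is scalar.\<close>
  proof (cases "b = 0")
    case True
    then show ?thesis
      using det_on_scalar[OF fin(1), of a] det_on_scalar[OF fin(2), of a] card by simp
  next
    case False
    then show ?thesis
      using card by (simp only: det_on_pencil[OF fin(1) False] det_on_pencil[OF fin(2) False] char)
  qed
  then show ?thesis
    by (simp only: det_on_pencil_add_const[OF fin(1) f nz] det_on_pencil_add_const[OF fin(2) g nz]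
        det_on_one_plus_const[OF fin card])
qed

section \<open>The common row sum as the largest real eigenvalue\<close>

text \<open>The all-ones vector is an eigenvector for \<open>r\<close>.\<close>

lemma det_on_row_sum_eq_0:
  assumes "finite V" "V \<noteq> {}" "\<And>u. u \<in> V \<Longrightarrow> (\<Sum>v\<in>V. f u v) = r"
  shows "det_on V (\<lambda>u v. (if u = v then r else 0) - f u v) = 0"
  unfolding det_on_eq_0_iff[OF assms(1)]
proof (intro exI[of _ "\<lambda>_. 1"] conjI ballI)
  fix u assume u: "u \<in> V"
  have "(\<Sum>v\<in>V. (if u = v then r else 0) - f u v) = 0"
    using assms u by (simp add: sum_subtractf)
  then show "(\<Sum>v\<in>V. complex_of_real ((if u = v then r else 0) - f u v) * 1) = 0"
    by (simp only: mult_1_right of_real_0 flip: of_real_sum)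
qed (use assms in auto)

text \<open>Maximum principle: at an index \<open>u\<close> where a kernel vector \<open>y\<close>
  has its largest modulus \<open>M > 0\<close>, the triangle inequality in row \<open>u\<close>
  gives \<bar>x\<bar> M \<le> r M, which contradicts r < x.\<close>

lemma det_on_greater_row_sum_neq_0:
  assumes fin: "finite V" and nonneg: "\<And>u v. 0 \<le> f u v"
    and row: "\<And>u. u \<in> V \<Longrightarrow> (\<Sum>v\<in>V. f u v) = r" and x: "r < x"
  shows "det_on V (\<lambda>u v. (if u = v then x else 0) - f u v) \<noteq> 0"
proof
  assume "det_on V (\<lambda>u v. (if u = v then x else 0) - f u v) = 0"
  then obtain y where y: "\<exists>v\<in>V. y v \<noteq> 0"
    "\<And>u. u \<in> V \<Longrightarrow> (\<Sum>v\<in>V. complex_of_real ((if u = v then x else 0) - f u v) * y v) = 0"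
    unfolding det_on_eq_0_iff[OF fin] by blast
  define M where "M = Max ((\<lambda>v. cmod (y v)) ` V)"
  have M: "cmod (y v) \<le> M" if "v \<in> V" for v
    using that fin by (simp add: M_def)
  have "V \<noteq> {}"
    using y(1) by blast
  then have "M \<in> (\<lambda>v. cmod (y v)) ` V"
    unfolding M_def using fin by (intro Max_in) auto
  then obtain u where u: "u \<in> V" "cmod (y u) = M"
    by auto
  have "M > 0"
    using y(1) M by (meson less_le_trans zero_less_norm_iff)
  have "(\<Sum>v\<in>V. complex_of_real ((if u = v then x else 0) - f u v) * y v)
      = (\<Sum>v\<in>V. (if u = v then complex_of_real x * y u else 0) - complex_of_real (f u v) * y v)"
    by (intro sum.cong) (auto simp: algebra_simps)
  then have "complex_of_real x * y u = (\<Sum>v\<in>V. complex_of_real (f u v) * y v)"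
    using y(2)[OF u(1)] u(1) fin by (simp add: sum_subtractf)
  then have "\<bar>x\<bar> * M = cmod (\<Sum>v\<in>V. complex_of_real (f u v) * y v)"
    using u(2) by (metis norm_mult norm_of_real)
  also have "\<dots> \<le> (\<Sum>v\<in>V. f u v * M)"
    using nonneg M by (intro sum_norm_le) (auto simp: norm_mult intro!: mult_left_mono)
  also have "\<dots> = r * M"
    using row[OF u(1)] by (simp flip: sum_distrib_right)
  also have "\<dots> < x * M"
    using x \<open>M > 0\<close> by simp
  finally show False
    using \<open>M > 0\<close> mult_right_mono[OF abs_ge_self[of x], of M] by linarith
qed

text \<open>Each row sum is a root of its own characteristic determinant, and no larger real number
  is. If the determinants agree, neither row sum can exceed the other.\<close>

lemma row_sums_eq_of_det_on_char_eq:
  assumes V: "finite V" "V \<noteq> {}" "\<And>u v. 0 \<le> f u v" "\<And>u. u \<in> V \<Longrightarrow> (\<Sum>v\<in>V. f u v) = r"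
    and W: "finite W" "W \<noteq> {}" "\<And>u v. 0 \<le> g u v" "\<And>u. u \<in> W \<Longrightarrow> (\<Sum>v\<in>W. g u v) = s"
    and char: "\<And>x. det_on V (\<lambda>u v. (if u = v then x else 0) - f u v)
      = det_on W (\<lambda>u v. (if u = v then x else 0) - g u v)"
  shows "r = s"
proof -
  have "\<not> r < s"
    using det_on_greater_row_sum_neq_0[where f = f and r = r, OF V(1,3,4)]
      det_on_row_sum_eq_0[where f = g and r = s, OF W(1,2,4)] by (auto simp: char)
  moreover have "\<not> s < r"
    using det_on_greater_row_sum_neq_0[where f = g and r = s, OF W(1,3,4)]
      det_on_row_sum_eq_0[where f = f and r = r, OF V(1,2,4)] by (auto simp flip: char)
  ultimately show ?thesis
    by simp
qed

section \<open>Distances and isomorphisms\<close>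

text \<open>Replacing walks by relational powers reduces distance proofs to unfolding small powers
  of the arc relation. The hypothesis on \<open>u\<close> matters for length 0: the empty walk
  starts at a vertex, whereas the zeroth power relates every element to itself.\<close>

lemma (in pair_wf_digraph) ex_awalk_length_iff:
  "u \<in> pverts G \<Longrightarrow> (\<exists>p. awalk u p v \<and> length p = n) \<longleftrightarrow> (u, v) \<in> parcs G ^^ n"
proof (induction n arbitrary: u)
  case 0
  then show ?case
    by (auto simp: awalk_Nil_iff)
next
  case (Suc n)
  show ?case
  proof
    assume "\<exists>p. awalk u p v \<and> length p = Suc n"
    then obtain x w p where p: "awalk u ((x, w) # p) v" "length p = n"
      by (auto simp: length_Suc_conv)
    then have "(u, w) \<in> parcs G" "awalk w p v"
      by (auto simp: awalk_Cons_iff)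
    then show "(u, v) \<in> parcs G ^^ Suc n"
      using Suc.IH[of w] in_arcsD2 p(2) by (blast intro: relpow_Suc_I2)
  next
    assume "(u, v) \<in> parcs G ^^ Suc n"
    then obtain w where w: "(u, w) \<in> parcs G" "(w, v) \<in> parcs G ^^ n"
      by (meson relpow_Suc_D2)
    then obtain p where "awalk w p v" "length p = n"
      using Suc.IH[of w] in_arcsD2 by blast
    then have "awalk u ((u, w) # p) v" "length ((u, w) # p) = Suc n"
      using w by (auto simp: awalk_Cons_iff)
    then show "\<exists>p. awalk u p v \<and> length p = Suc n"
      by blast
  qed
qed

context pair_wf_digraph
begin

lemma graph_dist_eqI:
  assumes "u \<in> pverts G" "(u, v) \<in> parcs G ^^ n" "\<And>k. k < n \<Longrightarrow> (u, v) \<notin> parcs G ^^ k"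
  shows "graph_dist G u v = n"
  unfolding graph_dist_def ex_awalk_length_iff[OF assms(1)]
  using assms(2,3) by (intro Least_equality) (auto simp: not_le[symmetric])

lemma graph_dist_self: "u \<in> pverts G \<Longrightarrow> graph_dist G u u = 0"
  by (rule graph_dist_eqI) auto

lemma graph_dist_eq_1: "(u, v) \<in> parcs G \<Longrightarrow> u \<noteq> v \<Longrightarrow> graph_dist G u v = 1"
  by (rule graph_dist_eqI) (auto intro: in_arcsD1)

lemma graph_dist_eq_2:
  assumes "u \<noteq> v" "(u, v) \<notin> parcs G" "(u, x) \<in> parcs G" "(x, v) \<in> parcs G"
  shows "graph_dist G u v = 2"
  by (rule graph_dist_eqI)
    (use assms in \<open>auto intro: in_arcsD1 simp: numeral_2_eq_2 less_Suc_eq relcomp_unfold\<close>)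

lemma graph_dist_eq_3:
  assumes "u \<noteq> v" "(u, v) \<notin> parcs G" "\<And>x. (u, x) \<in> parcs G \<Longrightarrow> (x, v) \<notin> parcs G"
    and "(u, x) \<in> parcs G" "(x, y) \<in> parcs G" "(y, v) \<in> parcs G"
  shows "graph_dist G u v = 3"
  by (rule graph_dist_eqI)
    (use assms in \<open>auto intro: in_arcsD1 simp: numeral_3_eq_3 less_Suc_eq relcomp_unfold\<close>)

lemma graph_dist_eq_4:
  assumes "u \<noteq> v" "(u, v) \<notin> parcs G" "\<And>x. (u, x) \<in> parcs G \<Longrightarrow> (x, v) \<notin> parcs G"
    and "\<And>x y. (u, x) \<in> parcs G \<Longrightarrow> (x, y) \<in> parcs G \<Longrightarrow> (y, v) \<notin> parcs G"
    and "(u, x) \<in> parcs G" "(x, y) \<in> parcs G" "(y, z) \<in> parcs G" "(z, v) \<in> parcs G"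
  shows "graph_dist G u v = 4"
proof (rule graph_dist_eqI)
  have 4: "4 = Suc (Suc (Suc (Suc 0)))"
    by simp
  show "(u, v) \<in> parcs G ^^ 4"
    using assms(5-8) unfolding 4 by (auto simp: relcomp_unfold)
  show "(u, v) \<notin> parcs G ^^ k" if "k < 4" for k
    using that assms(1-4) unfolding 4 by (auto simp: less_Suc_eq relcomp_unfold)
qed (use assms(5) in_arcsD1 in blast)

end

lemma (in pair_graph) graph_dist_commute:
  assumes "u \<in> pverts G" "v \<in> pverts G"
  shows "graph_dist G u v = graph_dist G v u"
proof -
  have "(v, u) \<in> parcs G ^^ n" if "(u, v) \<in> parcs G ^^ n" for u v n
    using that
  proof (induction n arbitrary: v)
    case (Suc n)
    then show ?case
      using arcs_symmetric by (meson relpow_Suc_E relpow_Suc_I2)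
  qed simp
  then have "(u, v) \<in> parcs G ^^ n \<longleftrightarrow> (v, u) \<in> parcs G ^^ n" for n
    by blast
  then show ?thesis
    unfolding graph_dist_def ex_awalk_length_iff[OF assms(1)] ex_awalk_length_iff[OF assms(2)]
    by simp
qed

section \<open>Isomorphisms of simple graphs as vertex bijections\<close>

text \<open>A general digraph isomorphism also maps arcs and replaces the tail and head functions.
  In a graph whose arcs are pairs, the arc map is forced by the vertex map.\<close>

lemma digraph_iso_with_proj_iff:
  assumes "pair_graph G" "pair_graph H"
  shows "digraph_iso (with_proj G) (with_proj H) \<longleftrightarrow>
    (\<exists>\<phi>. bij_betw \<phi> (pverts G) (pverts H) \<and>
      (\<forall>u\<in>pverts G. \<forall>v\<in>pverts G. (u, v) \<in> parcs G \<longleftrightarrow> (\<phi> u, \<phi> v) \<in> parcs H))"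
    (is "?L \<longleftrightarrow> ?R")
proof
  interpret G: pair_graph G by fact
  interpret H: pair_graph H by fact
  {
    assume ?L
    then obtain f where f: "pre_digraph.digraph_isomorphism (with_proj G) f"
      and H: "with_proj H = app_iso f (with_proj G)"
      unfolding digraph_iso_def by blast
    let ?\<phi> = "iso_verts f"
    have inj: "inj_on ?\<phi> (pverts G)"
      using f by (simp add: G.digraph_isomorphism_def)
    have verts: "pverts H = ?\<phi> ` pverts G" and arcs: "parcs H = iso_arcs f ` parcs G"
      using arg_cong[OF H, of verts] arg_cong[OF H, of arcs] by simp_all
    \<comment> \<open>The target is again a graph of pairs, so the tail and head functions supplied
      by the isomorphism must be the projections.\<close>
    have ends: "iso_tail f = fst" "iso_head f = snd"
      using arg_cong[OF H, of tail] arg_cong[OF H, of head] by simp_all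
    have arc: "iso_arcs f (u, v) = (?\<phi> u, ?\<phi> v)" if "(u, v) \<in> parcs G" for u v
      using G.iso_verts_tail[OF f that] G.iso_verts_head[OF f that] by (simp add: ends prod_eq_iff)
    have "(u, v) \<in> parcs G" if "u \<in> pverts G" "v \<in> pverts G" "(?\<phi> u, ?\<phi> v) \<in> parcs H" for u v
    proof -
      obtain x y where xy: "(x, y) \<in> parcs G" "(?\<phi> u, ?\<phi> v) = iso_arcs f (x, y)"
        using \<open>(?\<phi> u, ?\<phi> v) \<in> parcs H\<close> arcs by auto
      then have "?\<phi> u = ?\<phi> x" "?\<phi> v = ?\<phi> y"
        using arc by auto
      then show ?thesis
        using xy(1) that(1,2) G.in_arcsD1[OF xy(1)] G.in_arcsD2[OF xy(1)] inj
        by (auto simp: inj_on_eq_iff)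
    qed
    moreover have "(?\<phi> u, ?\<phi> v) \<in> parcs H" if "(u, v) \<in> parcs G" for u v
      using imageI[OF that, of "iso_arcs f"] by (simp add: arcs arc[OF that])
    ultimately show ?R
      using inj verts by (intro exI[of _ ?\<phi>]) (auto simp: bij_betw_def)
  next
    assume ?R
    then obtain \<phi> where \<phi>: "inj_on \<phi> (pverts G)" "\<phi> ` pverts G = pverts H"
      "\<And>u v. u \<in> pverts G \<Longrightarrow> v \<in> pverts G \<Longrightarrow> (u, v) \<in> parcs G \<longleftrightarrow> (\<phi> u, \<phi> v) \<in> parcs H"
      unfolding bij_betw_def by blast
    define f where "f = \<lparr>iso_verts = \<phi>, iso_arcs = map_prod \<phi> \<phi>, iso_head = snd, iso_tail = fst\<rparr>"
    have "inj_on (map_prod \<phi> \<phi>) (parcs G)"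
      using map_prod_inj_on[OF \<phi>(1,1)]
      by (rule inj_on_subset) (auto dest: G.in_arcsD1 G.in_arcsD2)
    then have "G.digraph_isomorphism f"
      using \<phi>(1) G.wf_digraph_axioms by (auto simp: G.digraph_isomorphism_def f_def)
    moreover have "parcs H = map_prod \<phi> \<phi> ` parcs G"
    proof (rule equalityI; rule subsetI)
      fix a assume a: "a \<in> parcs H"
      then have "fst a \<in> \<phi> ` pverts G" "snd a \<in> \<phi> ` pverts G"
        using \<phi>(2) H.arc_fst_in_verts H.arc_snd_in_verts by auto
      then obtain u v where uv: "u \<in> pverts G" "v \<in> pverts G" "a = (\<phi> u, \<phi> v)"
        by (auto simp: prod_eq_iff)
      then have "(u, v) \<in> parcs G"
        using a \<phi>(3) by simp
      then show "a \<in> map_prod \<phi> \<phi> ` parcs G"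
        using uv(3) by (auto intro!: image_eqI[of _ _ "(u, v)"])
    next
      fix a assume "a \<in> map_prod \<phi> \<phi> ` parcs G"
      then show "a \<in> parcs H"
        using \<phi>(3) by (auto dest: G.in_arcsD1 G.in_arcsD2)
    qed
    then have "with_proj H = app_iso f (with_proj G)"
      using \<phi>(2) by (simp add: f_def app_iso_def with_proj_def)
    ultimately show ?L
      unfolding digraph_iso_def by blast
  }
qed

section \<open>The subdivision-edge join\<close>

lemma (in pair_graph) doubleton_in_graph_edges_iff: "{u, v} \<in> graph_edges G \<longleftrightarrow> (u, v) \<in> parcs G"
  using arcs_symmetric by (fastforce simp: graph_edges_def doubleton_eq_iff)

lemma (in pair_graph) graph_edgesE:
  assumes "e \<in> graph_edges G"
  obtains u v where "e = {u, v}" "(u, v) \<in> parcs G" "u \<noteq> v" "u \<in> pverts G" "v \<in> pverts G"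
  using assms in_arcsD1 in_arcsD2 no_loops' by (auto simp: graph_edges_def)

lemma (in pair_graph) graph_edge_eqI:
  assumes "e \<in> graph_edges G" "u \<in> e" "v \<in> e" "u \<noteq> v"
  shows "e = {u, v}"
  using assms by (elim graph_edgesE) auto

lemma (in pair_graph) finite_graph_edges: "finite (graph_edges G)"
  using pair_finite_arcs by (simp add: graph_edges_def)

lemma (in pair_graph) out_degree_eq_card: "out_degree G v = card {w. (v, w) \<in> parcs G}"
proof -
  have "out_arcs G v = Pair v ` {w. (v, w) \<in> parcs G}"
    by (auto simp: out_arcs_def)
  then show ?thesis
    by (simp add: out_degree_def card_image inj_on_def)
qed

lemma (in pair_graph) sum_adjacency_entry:
  "(\<Sum>w\<in>pverts G. adjacency_entry G v w) = real (out_degree G v)"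
proof -
  have "{w \<in> pverts G. (v, w) \<in> parcs G} = {w. (v, w) \<in> parcs G}"
    using in_arcsD2 by auto
  then show ?thesis
    using pair_finite_verts
    by (simp add: adjacency_entry_def out_degree_eq_card flip: sum.inter_filter)
qed

lemma (in pair_graph) bij_betw_incident_edges:
  "bij_betw (\<lambda>w. {v, w}) {w. (v, w) \<in> parcs G} {e \<in> graph_edges G. v \<in> e}"
proof (rule bij_betwI')
  fix e assume e: "e \<in> {e \<in> graph_edges G. v \<in> e}"
  then obtain w where "e = {v, w}"
    by (auto elim: graph_edgesE)
  then show "\<exists>w\<in>{w. (v, w) \<in> parcs G}. e = {v, w}"
    using e doubleton_in_graph_edges_iff by blast
qed (auto simp: doubleton_eq_iff doubleton_in_graph_edges_iff)

lemma (in pair_graph) card_incident_edges: "card {e \<in> graph_edges G. v \<in> e} = out_degree G v"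
  using bij_betw_same_card[OF bij_betw_incident_edges] by (simp add: out_degree_eq_card)

lemma (in pair_graph) sum_incident: "(\<Sum>e\<in>graph_edges G. of_bool (v \<in> e)) = real (out_degree G v)"
  using finite_graph_edges by (simp add: card_incident_edges[symmetric] Int_def)

text \<open>Double counting of incident pairs of a vertex and an edge. For regular graphs it makes
  the number of edges a function of order and degree.\<close>

lemma (in pair_graph) handshake: "(\<Sum>v\<in>pverts G. out_degree G v) = 2 * card (graph_edges G)"
proof -
  have "(\<Sum>v\<in>pverts G. out_degree G v)
      = (\<Sum>v\<in>pverts G. \<Sum>e\<in>graph_edges G. of_bool (v \<in> e))"
    using finite_graph_edges by (simp add: card_incident_edges[symmetric] Int_def)
  also have "\<dots> = (\<Sum>e\<in>graph_edges G. \<Sum>v\<in>pverts G. of_bool (v \<in> e))"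
    by (rule sum.swap)
  also have "\<dots> = (\<Sum>e\<in>graph_edges G. 2)"
  proof (rule sum.cong[OF refl])
    fix e assume "e \<in> graph_edges G"
    then have "card (pverts G \<inter> e) = 2"
      by (elim graph_edgesE) (simp add: Int_absorb1)
    then show "(\<Sum>v\<in>pverts G. of_bool (v \<in> e)) = (2 :: nat)"
      using pair_finite_verts by (simp add: Int_def)
  qed
  finally show ?thesis
    by simp
qed

text \<open>These are the entries of R R^T for the incidence matrix R. Two distinct vertices lie
  together on at most one edge, namely \<open>{u, v}\<close>.\<close>

lemma (in pair_graph) sum_common_incident:
  assumes "u \<in> pverts G" "v \<in> pverts G"
  shows "(\<Sum>e\<in>graph_edges G. of_bool (u \<in> e) * of_bool (v \<in> e))
    = (if u = v then real (out_degree G u) else adjacency_entry G u v)"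
proof (cases "u = v")
  case True
  have "(\<Sum>e\<in>graph_edges G. of_bool (v \<in> e) * of_bool (v \<in> e) :: real)
      = (\<Sum>e\<in>graph_edges G. of_bool (v \<in> e))"
    by (intro sum.cong) auto
  also note sum_incident
  finally show ?thesis
    unfolding True by simp
next
  case False
  have "{e \<in> graph_edges G. u \<in> e \<and> v \<in> e} = (if (u, v) \<in> parcs G then {{u, v}} else {})"
  proof (rule Set.set_eqI)
    fix e
    have "e \<in> graph_edges G \<and> u \<in> e \<and> v \<in> e \<longleftrightarrow> e = {u, v} \<and> (u, v) \<in> parcs G"
      using graph_edge_eqI[of e, OF _ _ _ False] unfolding doubleton_in_graph_edges_iff[symmetric]
      by blast
    then show "e \<in> {e \<in> graph_edges G. u \<in> e \<and> v \<in> e}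
        \<longleftrightarrow> e \<in> (if (u, v) \<in> parcs G then {{u, v}} else {})"
      by simp
  qed
  moreover have "(\<Sum>e\<in>graph_edges G. of_bool (u \<in> e) * of_bool (v \<in> e))
      = real (card {e \<in> graph_edges G. u \<in> e \<and> v \<in> e})"
    using finite_graph_edges by (simp add: Int_def flip: of_bool_conj)
  ultimately show ?thesis
    using False by (simp add: adjacency_entry_def)
qed

section \<open>Arcs, distances and connectedness of the join\<close>

lemma parcs_subdivision_edge_join [simp]:
  "(Inl (Inl u), Inl (Inl v)) \<notin> parcs (subdivision_edge_join G H)"
  "(Inl (Inr e), Inl (Inr f)) \<notin> parcs (subdivision_edge_join G H)"
  "(Inl (Inl u), Inr h) \<notin> parcs (subdivision_edge_join G H)"
  "(Inr h, Inl (Inl u)) \<notin> parcs (subdivision_edge_join G H)"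
  "(Inl (Inl u), Inl (Inr e)) \<in> parcs (subdivision_edge_join G H) \<longleftrightarrow> e \<in> graph_edges G \<and> u \<in> e"
  "(Inl (Inr e), Inl (Inl u)) \<in> parcs (subdivision_edge_join G H) \<longleftrightarrow> e \<in> graph_edges G \<and> u \<in> e"
  "(Inl (Inr e), Inr h) \<in> parcs (subdivision_edge_join G H) \<longleftrightarrow> e \<in> graph_edges G \<and> h \<in> pverts H"
  "(Inr h, Inl (Inr e)) \<in> parcs (subdivision_edge_join G H) \<longleftrightarrow> e \<in> graph_edges G \<and> h \<in> pverts H"
  "(Inr h, Inr k) \<in> parcs (subdivision_edge_join G H) \<longleftrightarrow> (h, k) \<in> parcs H"
  by (auto simp: subdivision_edge_join_def subdivision_graph_def subdivision_vertices_def map_prod_def)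

lemma pverts_subdivision_edge_join:
  "pverts (subdivision_edge_join G H)
    = Inl ` (Inl ` pverts G \<union> Inr ` graph_edges G) \<union> Inr ` pverts H"
  by (simp add: subdivision_edge_join_def subdivision_graph_def)

lemma in_pverts_subdivision_edge_join [simp]:
  "Inl (Inl u) \<in> pverts (subdivision_edge_join G H) \<longleftrightarrow> u \<in> pverts G"
  "Inl (Inr e) \<in> pverts (subdivision_edge_join G H) \<longleftrightarrow> e \<in> graph_edges G"
  "Inr h \<in> pverts (subdivision_edge_join G H) \<longleftrightarrow> h \<in> pverts H"
  by (auto simp: pverts_subdivision_edge_join)

text \<open>The condition \<open>0 < r\<close> puts every vertex of \<open>G\<close> on an edge, so
  that a subdivision vertex links it to \<open>H\<close>.\<close>

locale regular_join = G: pair_graph G + H: pair_graph H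
  for G :: "'a pair_pre_digraph" and H :: "'b pair_pre_digraph" +
  fixes r :: nat
  assumes G_nonempty: "pverts G \<noteq> {}"
    and H_nonempty: "pverts H \<noteq> {}"
    and out_degree_G: "v \<in> pverts G \<Longrightarrow> out_degree G v = r"
    and r_pos: "0 < r"
begin

abbreviation "J \<equiv> subdivision_edge_join G H"

sublocale J: pair_graph J
  by (intro pair_graph_subdivision_edge_join G.pair_graph_axioms H.pair_graph_axioms)

lemma finite_pverts_J: "finite (pverts J)"
  by (rule J.pair_finite_verts)

lemma ex_incident_edge:
  assumes "v \<in> pverts G"
  shows "\<exists>e\<in>graph_edges G. v \<in> e"
proof -
  have "card {e \<in> graph_edges G. v \<in> e} > 0"
    using G.card_incident_edges out_degree_G[OF assms] r_pos by simp
  then show ?thesis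
    by (auto simp: card_gt_0_iff)
qed

lemma ex_edge: "\<exists>e. e \<in> graph_edges G"
  using ex_incident_edge G_nonempty by blast

text \<open>The neighbours of a vertex of \<open>G\<close> are subdivision vertices, and these are
  pairwise nonadjacent, so length 3 is impossible. Length 2 means a common edge; otherwise the route
  leads over an edge at \<open>u\<close>, a vertex of \<open>H\<close> and an edge at
  \<open>v\<close>.\<close>

lemma dist_vertex_vertex:
  assumes "u \<in> pverts G" "v \<in> pverts G"
  shows "graph_dist J (Inl (Inl u)) (Inl (Inl v))
    = (if u = v then 0 else if (u, v) \<in> parcs G then 2 else 4)"
proof -
  obtain e f h where efh: "e \<in> graph_edges G" "u \<in> e" "f \<in> graph_edges G" "v \<in> f" "h \<in> pverts H"
    using assms ex_incident_edge H_nonempty by blast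
  have 2: "graph_dist J (Inl (Inl u)) (Inl (Inl v)) = 2" if "u \<noteq> v" "(u, v) \<in> parcs G"
    using that by (intro J.graph_dist_eq_2[of _ _ "Inl (Inr {u, v})"])
      (auto simp: G.doubleton_in_graph_edges_iff)
  have no_common: "\<not> (e \<in> graph_edges G \<and> u \<in> e \<and> v \<in> e)" if "u \<noteq> v" "(u, v) \<notin> parcs G" for e
    using that G.graph_edge_eqI by (metis G.doubleton_in_graph_edges_iff)
  have 4: "graph_dist J (Inl (Inl u)) (Inl (Inl v)) = 4" if "u \<noteq> v" "(u, v) \<notin> parcs G"
  proof (rule J.graph_dist_eq_4[of _ _ "Inl (Inr e)" "Inr h" "Inl (Inr f)"])
    fix x assume "(Inl (Inl u), x) \<in> parcs J"
    then show "(x, Inl (Inl v)) \<notin> parcs J"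
      using no_common[OF that] by (cases x; cases "projl x") auto
  next
    fix x y assume "(Inl (Inl u), x) \<in> parcs J" "(x, y) \<in> parcs J"
    then show "(y, Inl (Inl v)) \<notin> parcs J"
      by (cases x; cases "projl x"; cases y; cases "projl y") auto
  qed (use that efh in auto)
  show ?thesis
    using 2 4 J.graph_dist_self[of "Inl (Inl u)"] assms(1) by (cases "u = v") simp_all
qed

text \<open>If \<open>u\<close> is not on \<open>e\<close>, a walk of length 2 would join two
  subdivision vertices by an arc; a walk of length 3 passes through an edge at \<open>u\<close> and
  a vertex of \<open>H\<close>.\<close>

lemma dist_vertex_edge:
  assumes "u \<in> pverts G" "e \<in> graph_edges G"
  shows "graph_dist J (Inl (Inl u)) (Inl (Inr e)) = (if u \<in> e then 1 else 3)"
proof -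
  obtain f h where fh: "f \<in> graph_edges G" "u \<in> f" "h \<in> pverts H"
    using assms ex_incident_edge H_nonempty by blast
  have "graph_dist J (Inl (Inl u)) (Inl (Inr e)) = 3" if "u \<notin> e"
  proof (rule J.graph_dist_eq_3[of _ _ "Inl (Inr f)" "Inr h"])
    fix x assume "(Inl (Inl u), x) \<in> parcs J"
    then show "(x, Inl (Inr e)) \<notin> parcs J"
      by (cases x; cases "projl x") auto
  qed (use that fh assms in auto)
  then show ?thesis
    using J.graph_dist_eq_1[of "Inl (Inl u)" "Inl (Inr e)"] assms by simp
qed

lemma dist_edge_vertex:
  assumes "u \<in> pverts G" "e \<in> graph_edges G"
  shows "graph_dist J (Inl (Inr e)) (Inl (Inl u)) = (if u \<in> e then 1 else 3)"
  using dist_vertex_edge[OF assms] J.graph_dist_commute[of "Inl (Inr e)" "Inl (Inl u)"] assms by simp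

lemma dist_vertex_join:
  assumes "u \<in> pverts G" "h \<in> pverts H"
  shows "graph_dist J (Inl (Inl u)) (Inr h) = 2"
proof -
  obtain f where "f \<in> graph_edges G" "u \<in> f"
    using assms ex_incident_edge by blast
  then show ?thesis
    using assms by (intro J.graph_dist_eq_2[of _ _ "Inl (Inr f)"]) auto
qed

lemma dist_edge_edge:
  assumes "e \<in> graph_edges G" "f \<in> graph_edges G"
  shows "graph_dist J (Inl (Inr e)) (Inl (Inr f)) = (if e = f then 0 else 2)"
proof -
  obtain h where "h \<in> pverts H"
    using H_nonempty by blast
  then show ?thesis
    using assms J.graph_dist_self[of "Inl (Inr e)"]
      J.graph_dist_eq_2[of "Inl (Inr e)" "Inl (Inr f)" "Inr h"] by auto
qed

lemma dist_edge_join: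
  assumes "e \<in> graph_edges G" "h \<in> pverts H"
  shows "graph_dist J (Inl (Inr e)) (Inr h) = 1"
  using assms by (intro J.graph_dist_eq_1) auto

lemma dist_join_join:
  assumes "h \<in> pverts H" "k \<in> pverts H"
  shows "graph_dist J (Inr h) (Inr k) = (if h = k then 0 else if (h, k) \<in> parcs H then 1 else 2)"
proof -
  obtain f where "f \<in> graph_edges G"
    using ex_edge by blast
  then show ?thesis
    using assms J.graph_dist_self[of "Inr h"] J.graph_dist_eq_1[of "Inr h" "Inr k"]
      J.graph_dist_eq_2[of "Inr h" "Inr k" "Inl (Inr f)"] by auto
qed

lemma dist_join_vertex:
  assumes "u \<in> pverts G" "h \<in> pverts H"
  shows "graph_dist J (Inr h) (Inl (Inl u)) = 2"
  using dist_vertex_join[OF assms] J.graph_dist_commute[of "Inl (Inl u)" "Inr h"] assms by simp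

lemma dist_join_edge:
  assumes "e \<in> graph_edges G" "h \<in> pverts H"
  shows "graph_dist J (Inr h) (Inl (Inr e)) = 1"
  using dist_edge_join[OF assms] J.graph_dist_commute[of "Inl (Inr e)" "Inr h"] assms by simp

lemmas dist_simps = dist_vertex_vertex dist_vertex_edge dist_edge_vertex dist_vertex_join
  dist_edge_edge dist_edge_join dist_join_join dist_join_vertex dist_join_edge

text \<open>Every vertex reaches one fixed vertex \<open>h\<close> of \<open>H\<close>, and
  reachability is symmetric.\<close>

lemma connected_J: "Digraph_Component.connected J"
proof -
  obtain h where h: "h \<in> pverts H"
    using H_nonempty by blast
  have step: "x \<rightarrow>\<^sup>*\<^bsub>J\<^esub> y" if "(x, y) \<in> parcs J" for x y
    using that J.adj_mk_symmetric_eq J.reachable_adjI by simp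
  have edge: "Inl (Inr e) \<rightarrow>\<^sup>*\<^bsub>J\<^esub> Inr h" if "e \<in> graph_edges G" for e
    using that h by (intro step) simp
  have to_h: "x \<rightarrow>\<^sup>*\<^bsub>J\<^esub> Inr h" if x: "x \<in> pverts J" for x
  proof (cases x)
    case (Inr k)
    obtain e where "e \<in> graph_edges G"
      using ex_edge by blast
    then have "Inr k \<rightarrow>\<^sup>*\<^bsub>J\<^esub> Inl (Inr e)" "Inl (Inr e) \<rightarrow>\<^sup>*\<^bsub>J\<^esub> Inr h"
      using x Inr edge by (auto intro: step)
    then show ?thesis
      unfolding Inr by (rule J.reachable_trans)
  next
    case (Inl y)
    show ?thesis
    proof (cases y)
      case Inl': (Inl v)
      obtain e where "e \<in> graph_edges G" "v \<in> e"
        using ex_incident_edge x Inl Inl' by auto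
      then have "Inl (Inl v) \<rightarrow>\<^sup>*\<^bsub>J\<^esub> Inl (Inr e)" "Inl (Inr e) \<rightarrow>\<^sup>*\<^bsub>J\<^esub> Inr h"
        using edge by (auto intro: step)
      then show ?thesis
        unfolding Inl Inl' by (rule J.reachable_trans)
    next
      case (Inr e)
      then show ?thesis
        using x Inl edge by simp
    qed
  qed
  have "x \<rightarrow>\<^sup>*\<^bsub>J\<^esub> y" if "x \<in> pverts J" "y \<in> pverts J" for x y
    using J.reachable_trans[OF to_h[OF that(1)] J.symmetric_reachable'[OF to_h[OF that(2)]]] .
  moreover have "verts (mk_symmetric J) = pverts J"
    by (simp add: mk_symmetric_def)
  ultimately show ?thesis
    using H_nonempty unfolding connected_def strongly_connected_def J.reachable_mk_symmetric_eq[OF J.sym_arcs]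
    by (simp add: pverts_subdivision_edge_join)
qed

lemma eccentricity_join:
  assumes "h \<in> pverts H"
  shows "eccentricity J (Inr h) = 2"
proof -
  obtain u where "u \<in> pverts G"
    using G_nonempty by blast
  then have "2 \<in> (\<lambda>x. graph_dist J (Inr h) x) ` pverts J"
    using dist_join_vertex[OF _ assms, of u] by (intro image_eqI[of _ _ "Inl (Inl u)"]) auto
  moreover have "graph_dist J (Inr h) x \<le> 2" if "x \<in> pverts J" for x
    using that assms by (auto simp: pverts_subdivision_edge_join dist_simps)
  ultimately show ?thesis
    unfolding eccentricity_def using finite_pverts_J by (intro Max_eqI) auto
qed

lemma dist_le_eccentricity: "y \<in> pverts J \<Longrightarrow> graph_dist J x y \<le> eccentricity J x"
  unfolding eccentricity_def using finite_pverts_J by (intro Max_ge) auto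

lemma entry_join_join:
  assumes "h \<in> pverts H" "k \<in> pverts H"
  shows "eccentricity_entry J (Inr h) (Inr k) = (if h = k then 0 else 2 - 2 * adjacency_entry H h k)"
  using assms by (auto simp: eccentricity_entry_def eccentricity_join dist_join_join adjacency_entry_def)

end

section \<open>The eccentricity matrix of the join\<close>

context regular_join
begin

lemma ex_other_neighbour:
  assumes "2 \<le> r" "v \<in> pverts G"
  shows "\<exists>w. (v, w) \<in> parcs G \<and> w \<noteq> x"
proof (rule ccontr)
  assume "\<not> ?thesis"
  then have "{w. (v, w) \<in> parcs G} \<subseteq> {x}"
    by auto
  from card_mono[OF _ this] show False
    using assms out_degree_G[of v] by (simp add: G.out_degree_eq_card)
qed

text \<open>The value 3 is attained at a vertex of \<open>G\<close> outside \<open>e\<close>. Degree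
  at least 2 provides one: an end of \<open>e\<close> has a neighbour other than the opposite
  end.\<close>

lemma eccentricity_edge:
  assumes "2 \<le> r" "e \<in> graph_edges G"
  shows "eccentricity J (Inl (Inr e)) = 3"
proof -
  obtain a b where ab: "e = {a, b}" "a \<in> pverts G"
    using assms(2) by (elim G.graph_edgesE)
  obtain w where w: "(a, w) \<in> parcs G" "w \<noteq> b"
    using ex_other_neighbour[OF assms(1) ab(2)] by blast
  then have "w \<in> pverts G" "w \<notin> e"
    using ab(1) G.no_loops' G.in_arcsD2 by auto
  then have "3 \<in> graph_dist J (Inl (Inr e)) ` pverts J"
    using assms(2) dist_edge_vertex[of w e] by (intro image_eqI[of _ _ "Inl (Inl w)"]) auto
  moreover have "graph_dist J (Inl (Inr e)) x \<le> 3" if "x \<in> pverts J" for x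
    using that assms(2) by (auto simp: pverts_subdivision_edge_join dist_simps)
  ultimately show ?thesis
    unfolding eccentricity_def using finite_pverts_J by (intro Max_eqI) auto
qed

text \<open>An edge avoiding \<open>v\<close> lies at distance 3: take a neighbour \<open>a\<close>
  of \<open>v\<close> and a further neighbour of \<open>a\<close>. The eccentricity is 3 or 4, and
  this lower bound is all that the entries below depend on.\<close>

lemma eccentricity_vertex_ge:
  assumes "2 \<le> r" "v \<in> pverts G"
  shows "3 \<le> eccentricity J (Inl (Inl v))"
proof -
  obtain a where a: "(v, a) \<in> parcs G"
    using ex_other_neighbour[OF assms] by blast
  obtain w where w: "(a, w) \<in> parcs G" "w \<noteq> v"
    using ex_other_neighbour[OF assms(1) G.in_arcsD2[OF a]] by blast
  then have "{a, w} \<in> graph_edges G" "v \<notin> {a, w}"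
    using a G.no_loops' by (auto simp: G.doubleton_in_graph_edges_iff)
  then show ?thesis
    using dist_le_eccentricity[of "Inl (Inr {a, w})" "Inl (Inl v)"] assms(2)
    by (simp add: dist_vertex_edge)
qed

text \<open>Distance 4 forces both eccentricities to be 4, so it survives in the matrix; distance 2
  is below both eccentricities and is replaced by 0.\<close>

lemma entry_vertex_vertex:
  assumes "2 \<le> r" "u \<in> pverts G" "v \<in> pverts G"
  shows "eccentricity_entry J (Inl (Inl u)) (Inl (Inl v))
    = (if u = v then 0 else 4 - 4 * adjacency_entry G u v)"
proof -
  have "graph_dist J (Inl (Inl u)) (Inl (Inl v)) \<le> eccentricity J (Inl (Inl u))"
    "graph_dist J (Inl (Inl v)) (Inl (Inl u)) \<le> eccentricity J (Inl (Inl v))"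
    using assms dist_le_eccentricity by auto
  moreover have "eccentricity J (Inl (Inl w)) \<le> 4" if "w \<in> pverts G" for w
    unfolding eccentricity_def using finite_pverts_J that
    by (subst Max_le_iff) (auto simp: pverts_subdivision_edge_join dist_simps)
  ultimately show ?thesis
    using assms eccentricity_vertex_ge[OF assms(1), of u] eccentricity_vertex_ge[OF assms(1), of v]
      G.arcs_symmetric[of u v] G.arcs_symmetric[of v u]
    by (fastforce simp: eccentricity_entry_def dist_vertex_vertex adjacency_entry_def split: if_splits)
qed

lemma entry_vertex_edge:
  assumes "2 \<le> r" "u \<in> pverts G" "e \<in> graph_edges G"
  shows "eccentricity_entry J (Inl (Inl u)) (Inl (Inr e)) = 3 * (1 - of_bool (u \<in> e))"
    and "eccentricity_entry J (Inl (Inr e)) (Inl (Inl u)) = 3 * (1 - of_bool (u \<in> e))"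
  using assms eccentricity_vertex_ge[of u]
  by (auto simp: eccentricity_entry_def eccentricity_edge dist_vertex_edge dist_edge_vertex)

lemma entry_vertex_join:
  assumes "2 \<le> r" "u \<in> pverts G" "h \<in> pverts H"
  shows "eccentricity_entry J (Inl (Inl u)) (Inr h) = 2"
    and "eccentricity_entry J (Inr h) (Inl (Inl u)) = 2"
  using assms eccentricity_vertex_ge[of u]
  by (auto simp: eccentricity_entry_def eccentricity_join dist_vertex_join dist_join_vertex)

lemma entry_edge_edge:
  assumes "2 \<le> r" "e \<in> graph_edges G" "f \<in> graph_edges G"
  shows "eccentricity_entry J (Inl (Inr e)) (Inl (Inr f)) = 0"
  using assms by (auto simp: eccentricity_entry_def eccentricity_edge dist_edge_edge)

lemma entry_edge_join:
  assumes "2 \<le> r" "e \<in> graph_edges G" "h \<in> pverts H"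
  shows "eccentricity_entry J (Inl (Inr e)) (Inr h) = 0"
    and "eccentricity_entry J (Inr h) (Inl (Inr e)) = 0"
  using assms
  by (auto simp: eccentricity_entry_def eccentricity_edge eccentricity_join dist_edge_join dist_join_edge)

section \<open>Eliminating the vertex classes of the join with first factor of degree at least
  2\<close>

text \<open>Gram matrix of the all-ones matrix minus the incidence matrix: the two mixed terms
  contribute \<open>r\<close> each, and the product term is an entry of R R^T.\<close>

lemma sum_non_incident:
  assumes "u \<in> pverts G" "v \<in> pverts G"
  shows "(\<Sum>e\<in>graph_edges G. (1 - of_bool (u \<in> e)) * (1 - of_bool (v \<in> e)))
    = real (card (graph_edges G)) - 2 * real r + (if u = v then real r else adjacency_entry G u v)"
proof -
  have "(\<Sum>e\<in>graph_edges G. (1 - of_bool (u \<in> e)) * (1 - of_bool (v \<in> e)) :: real)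
      = (\<Sum>e\<in>graph_edges G. 1 - of_bool (u \<in> e) - of_bool (v \<in> e) + of_bool (u \<in> e) * of_bool (v \<in> e))"
    by (intro sum.cong) (auto simp: algebra_simps)
  also have "\<dots> = (\<Sum>e\<in>graph_edges G. 1) - (\<Sum>e\<in>graph_edges G. of_bool (u \<in> e))
      - (\<Sum>e\<in>graph_edges G. of_bool (v \<in> e)) + (\<Sum>e\<in>graph_edges G. of_bool (u \<in> e) * of_bool (v \<in> e))"
    by (simp only: sum.distrib sum_subtractf)
  also have "\<dots> = real (card (graph_edges G)) - real r - real r
      + (if u = v then real r else adjacency_entry G u v)"
    by (simp only: G.sum_incident G.sum_common_incident[OF assms] out_degree_G[OF assms(1)]
        out_degree_G[OF assms(2)] sum_constant mult_1_right)
  finally show ?thesis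
    by simp
qed

lemma adjacency_row_sum: "v \<in> pverts G \<Longrightarrow> (\<Sum>w\<in>pverts G. adjacency_entry G v w) = real r"
  by (simp add: G.sum_adjacency_entry out_degree_G)

lemma adjacency_entry_self: "adjacency_entry G v v = 0"
  using G.no_loops' by (auto simp: adjacency_entry_def)

text \<open>Two subdivision vertices have entry 0, so their block is x I and dividing by
  \<open>x\<close> solves the linear system of the elimination.\<close>

lemma det_on_join_eliminate_edges:
  assumes r: "2 \<le> r" and x: "x \<noteq> 0"
  defines "f \<equiv> \<lambda>u v. (if u = v then x else 0) - eccentricity_entry J u v"
  shows "det_on (pverts J) f
    = det_on (Inr ` pverts H \<union> Inl ` Inl ` pverts G)
        (\<lambda>u v. f u v - (\<Sum>e\<in>graph_edges G. f u (Inl (Inr e)) * f (Inl (Inr e)) v) / x)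
      * complex_of_real x ^ card (graph_edges G)"
proof -
  let ?V = "Inr ` pverts H \<union> Inl ` Inl ` pverts G :: (('a + 'a set) + 'b) set"
  let ?W = "Inl ` Inr ` graph_edges G :: (('a + 'a set) + 'b) set"
  have fin: "finite ?V" "finite ?W"
    using G.finite_graph_edges G.pair_finite_verts H.pair_finite_verts by auto
  have sum_W: "(\<Sum>w\<in>?W. k w) = (\<Sum>e\<in>graph_edges G. k (Inl (Inr e)))"
    for k :: "('a + 'a set) + 'b \<Rightarrow> real"
    by (simp add: sum.reindex inj_on_def)
  have f_W: "f u v = (if u = v then x else 0)" if "u \<in> ?W" "v \<in> ?W" for u v
    using that r by (auto simp: f_def entry_edge_edge)
  have "det_on (?V \<union> ?W) f
      = det_on ?V (\<lambda>u v. f u v - (\<Sum>w\<in>?W. f u w * (f w v / x))) * det_on ?W f"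
  proof (rule det_on_eliminate[OF fin])
    fix w v assume "w \<in> ?W"
    then have "(\<Sum>w'\<in>?W. f w w' * (f w' v / x)) = (\<Sum>w'\<in>?W. if w = w' then f w v else 0)"
      using x by (intro sum.cong) (auto simp: f_W)
    then show "(\<Sum>w'\<in>?W. f w w' * (f w' v / x)) = f w v"
      using fin(2) \<open>w \<in> ?W\<close> by simp
  qed auto
  moreover have "?V \<union> ?W = pverts J"
    by (auto simp: pverts_subdivision_edge_join)
  moreover have "det_on ?W f = complex_of_real x ^ card ?W"
    using det_on_cong[OF fin(2) f_W] det_on_scalar[OF fin(2)] by simp
  moreover have "card ?W = card (graph_edges G)"
    by (simp add: card_image inj_on_def)
  ultimately show ?thesis
    by (simp add: sum_W sum_divide_distrib)
qed

text \<open>The constants describe the block \<open>N\<close> left on the vertices of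
  \<open>G\<close> once the subdivision vertices are gone: \<open>c\<close> collects the constant
  terms, \<open>b\<close> the multiples of the adjacency matrix, and the 4 in \<open>a\<close>
  cancels the - 4 of \<open>c\<close> on the diagonal. The row sum of \<open>N\<close> is
  \<open>s\<close>.\<close>

lemma det_on_join_char:
  assumes r: "2 \<le> r" and x: "x \<noteq> 0"
    and a: "a = x + 4 - 9 * real r / x"
    and b: "b = 4 - 9 / x"
    and c: "c = - 4 - 9 / x * (real (card (graph_edges G)) - 2 * real r)"
    and s: "s = a + b * real r + c * real (card (pverts G))" "s \<noteq> 0"
  shows "det_on (pverts J) (\<lambda>u v. (if u = v then x else 0) - eccentricity_entry J u v)
    = det_on (pverts H) (\<lambda>h k. (if h = k then x else 0)
        - (if h = k then 0 else 2 - 2 * adjacency_entry H h k) - 4 * real (card (pverts G)) / s)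
      * det_on (pverts G) (\<lambda>u v. (if u = v then a else 0) + b * adjacency_entry G u v + c)
      * complex_of_real x ^ card (graph_edges G)"
proof -
  define f where "f u v = (if u = v then x else 0) - eccentricity_entry J u v" for u v
  define g where "g u v = f u v - (\<Sum>e\<in>graph_edges G. f u (Inl (Inr e)) * f (Inl (Inr e)) v) / x" for u v
  let ?V = "Inr ` pverts H :: (('a + 'a set) + 'b) set"
  let ?W = "(\<lambda>v. Inl (Inl v)) ` pverts G :: (('a + 'a set) + 'b) set"
  have fin: "finite ?V" "finite ?W"
    using G.pair_finite_verts H.pair_finite_verts by auto
  have inj: "inj_on Inr (pverts H)" "inj_on (\<lambda>v. Inl (Inl v)) (pverts G)"
    by (auto simp: inj_on_def)
  have sum_W: "(\<Sum>w\<in>?W. k w) = (\<Sum>v\<in>pverts G. k (Inl (Inl v)))"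
    for k :: "('a + 'a set) + 'b \<Rightarrow> real"
    by (rule sum.reindex[OF inj(2), unfolded o_def])
  have g_G: "g (Inl (Inl u)) (Inl (Inl v)) = (if u = v then a else 0) + b * adjacency_entry G u v + c"
    if uv: "u \<in> pverts G" "v \<in> pverts G" for u v
  proof -
    have "(\<Sum>e\<in>graph_edges G. f (Inl (Inl u)) (Inl (Inr e)) * f (Inl (Inr e)) (Inl (Inl v)))
        = (\<Sum>e\<in>graph_edges G. 9 * ((1 - of_bool (u \<in> e)) * (1 - of_bool (v \<in> e))))"
      using uv r by (intro sum.cong) (auto simp: f_def entry_vertex_edge)
    also have "\<dots> = 9 * (real (card (graph_edges G)) - 2 * real r
        + (if u = v then real r else adjacency_entry G u v))"
      by (simp only: sum_distrib_left[symmetric] sum_non_incident[OF uv])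
    finally have S: "(\<Sum>e\<in>graph_edges G. f (Inl (Inl u)) (Inl (Inr e)) * f (Inl (Inr e)) (Inl (Inl v)))
        = 9 * (real (card (graph_edges G)) - 2 * real r
          + (if u = v then real r else adjacency_entry G u v))" .
    have F: "f (Inl (Inl u)) (Inl (Inl v))
        = (if u = v then x else 0) - (if u = v then 0 else 4 - 4 * adjacency_entry G u v)"
      using uv r by (simp add: f_def entry_vertex_vertex)
    show ?thesis
      using x unfolding g_def S F a b c
      by (cases "u = v") (simp_all add: adjacency_entry_self field_simps)
  qed
  \<comment> \<open>Entries between subdivision vertices and \<open>H\<close> vanish, so the first
    elimination leaves these entries, and those inside \<open>H\<close>, unchanged.\<close>
  have g_GH: "g (Inl (Inl u)) (Inr h) = - 2" "g (Inr h) (Inl (Inl u)) = - 2"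
    if "u \<in> pverts G" "h \<in> pverts H" for u h
    using that r by (simp_all add: g_def f_def entry_vertex_join entry_edge_join)
  have g_H: "g (Inr h) (Inr k) = (if h = k then x else 0)
      - (if h = k then 0 else 2 - 2 * adjacency_entry H h k)"
    if "h \<in> pverts H" "k \<in> pverts H" for h k
    using that r by (simp add: g_def f_def entry_join_join entry_edge_join)
  \<comment> \<open>All coupling entries are - 2 and every row of the eliminated block sums to
    \<open>s\<close>, so the constant - 2 / s solves the system. It contributes (- 2) (- 2) / s for
    each vertex of \<open>G\<close>.\<close>
  have "det_on (?V \<union> ?W) g
      = det_on ?V (\<lambda>u v. g u v - (\<Sum>w\<in>?W. g u w * (- 2 / s))) * det_on ?W g"
  proof (rule det_on_eliminate[OF fin])
    fix w v assume "w \<in> ?W" "v \<in> ?V"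
    then obtain u h where uh: "w = Inl (Inl u)" "u \<in> pverts G" "v = Inr h" "h \<in> pverts H"
      by auto
    have "(\<Sum>w'\<in>?W. g w w') = (\<Sum>v\<in>pverts G. (if u = v then a else 0) + b * adjacency_entry G u v + c)"
      unfolding sum_W uh(1) using uh(2) by (intro sum.cong) (auto simp: g_G)
    also have "\<dots> = (\<Sum>v\<in>pverts G. if u = v then a else 0)
        + b * (\<Sum>v\<in>pverts G. adjacency_entry G u v) + (\<Sum>v\<in>pverts G. c)"
      by (simp only: sum.distrib sum_distrib_left)
    also have "\<dots> = s"
      using uh(2) G.pair_finite_verts by (simp add: adjacency_row_sum s(1))
    finally have "(\<Sum>w'\<in>?W. g w w' * (- 2 / s)) = - 2"
      using s(2) by (simp only: sum_distrib_right[symmetric]) simp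
    then show "(\<Sum>w'\<in>?W. g w w' * (- 2 / s)) = g w v"
      using uh by (simp add: g_GH)
  qed auto
  also have "det_on ?W g
      = det_on (pverts G) (\<lambda>u v. (if u = v then a else 0) + b * adjacency_entry G u v + c)"
    unfolding det_on_reindex[OF G.pair_finite_verts inj(2)]
    using G.pair_finite_verts g_G by (intro det_on_cong) auto
  also have "det_on ?V (\<lambda>u v. g u v - (\<Sum>w\<in>?W. g u w * (- 2 / s)))
      = det_on (pverts H) (\<lambda>h k. (if h = k then x else 0)
        - (if h = k then 0 else 2 - 2 * adjacency_entry H h k) - 4 * real (card (pverts G)) / s)"
    unfolding det_on_reindex[OF H.pair_finite_verts inj(1)] sum_W
    using H.pair_finite_verts by (intro det_on_cong) (simp_all add: g_H g_GH)
  finally show ?thesis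
    using det_on_join_eliminate_edges[OF r x] by (simp add: f_def g_def image_image)
qed

end

section \<open>Entries that do not depend on the second factor\<close>

text \<open>Only distances between two vertices of the second factor refer to its arcs; the formulas
  for all other distances involve the first factor alone.\<close>

lemma regular_joins_dist_eq:
  assumes "regular_join G H r" "regular_join G H' r"
    and x: "x \<in> Inl ` pverts G \<union> Inr ` graph_edges G" and y: "y \<in> Inl ` pverts G \<union> Inr ` graph_edges G"
    and h: "h \<in> pverts H" and h': "h' \<in> pverts H'"
  shows "graph_dist (subdivision_edge_join G H) (Inl x) (Inl y)
      = graph_dist (subdivision_edge_join G H') (Inl x) (Inl y)"
    and "graph_dist (subdivision_edge_join G H) (Inl x) (Inr h)
      = graph_dist (subdivision_edge_join G H') (Inl x) (Inr h')"
    and "graph_dist (subdivision_edge_join G H) (Inr h) (Inl x)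
      = graph_dist (subdivision_edge_join G H') (Inr h') (Inl x)"
proof -
  interpret A: regular_join G H r by fact
  interpret B: regular_join G H' r by fact
  show "graph_dist A.J (Inl x) (Inl y) = graph_dist B.J (Inl x) (Inl y)"
    "graph_dist A.J (Inl x) (Inr h) = graph_dist B.J (Inl x) (Inr h')"
    "graph_dist A.J (Inr h) (Inl x) = graph_dist B.J (Inr h') (Inl x)"
    using x y h h' by (auto simp: A.dist_simps B.dist_simps)
qed

text \<open>The eccentricity of a vertex of S(G) sees the second factor only through one common
  distance, and vertices of the second factor always have eccentricity 2.\<close>

lemma regular_joins_entry_eq:
  assumes AB: "regular_join G H r" "regular_join G H' r"
    and x: "x \<in> Inl ` pverts G \<union> Inr ` graph_edges G" and y: "y \<in> Inl ` pverts G \<union> Inr ` graph_edges G"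
    and h: "h \<in> pverts H" and h': "h' \<in> pverts H'"
  shows "eccentricity_entry (subdivision_edge_join G H) (Inl x) (Inl y)
      = eccentricity_entry (subdivision_edge_join G H') (Inl x) (Inl y)"
    and "eccentricity_entry (subdivision_edge_join G H) (Inl x) (Inr h)
      = eccentricity_entry (subdivision_edge_join G H') (Inl x) (Inr h')"
    and "eccentricity_entry (subdivision_edge_join G H) (Inr h) (Inl x)
      = eccentricity_entry (subdivision_edge_join G H') (Inr h') (Inl x)"
proof -
  interpret A: regular_join G H r by fact
  interpret B: regular_join G H' r by fact
  have ecc: "eccentricity A.J (Inl x) = eccentricity B.J (Inl x)"
    if x: "x \<in> Inl ` pverts G \<union> Inr ` graph_edges G" for x
  proof -
    have "graph_dist A.J (Inl x) ` Inl ` (Inl ` pverts G \<union> Inr ` graph_edges G)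
        = graph_dist B.J (Inl x) ` Inl ` (Inl ` pverts G \<union> Inr ` graph_edges G)"
      unfolding image_image using regular_joins_dist_eq(1)[OF AB x _ h h'] by (intro image_cong) auto
    moreover have "graph_dist A.J (Inl x) ` Inr ` pverts H = {graph_dist A.J (Inl x) (Inr h)}"
      using regular_joins_dist_eq(2)[OF AB x x _ h'] h by fastforce
    moreover have "graph_dist B.J (Inl x) ` Inr ` pverts H' = {graph_dist A.J (Inl x) (Inr h)}"
      using regular_joins_dist_eq(2)[OF AB x x h] h' by fastforce
    ultimately show ?thesis
      by (simp only: eccentricity_def pverts_subdivision_edge_join image_Un)
  qed
  show "eccentricity_entry A.J (Inl x) (Inl y) = eccentricity_entry B.J (Inl x) (Inl y)"
    "eccentricity_entry A.J (Inl x) (Inr h) = eccentricity_entry B.J (Inl x) (Inr h')"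
    "eccentricity_entry A.J (Inr h) (Inl x) = eccentricity_entry B.J (Inr h') (Inl x)"
    using h h' regular_joins_dist_eq[OF AB x y h h']
    by (simp_all add: eccentricity_entry_def ecc[OF x] ecc[OF y] A.eccentricity_join B.eccentricity_join)
qed

context regular_join
begin

text \<open>Here the second factor is eliminated. The first factor may have degree 1, where its
  eccentricities differ from those computed for degree at least 2, so the remaining block keeps its
  entries unevaluated; \<open>regular_joins_entry_eq\<close> suffices to compare them.\<close>

lemma det_on_join_char':
  assumes k: "\<And>h. h \<in> pverts H \<Longrightarrow> out_degree H h = k"
    and s: "s = x + 2 + 2 * real k - 2 * real (card (pverts H))" "s \<noteq> 0"
    and h0: "h0 \<in> pverts H"
  shows "det_on (pverts J) (\<lambda>u v. (if u = v then x else 0) - eccentricity_entry J u v)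
    = det_on (Inl ` pverts G \<union> Inr ` graph_edges G)
        (\<lambda>u v. (if u = v then x else 0) - eccentricity_entry J (Inl u) (Inl v)
          - real (card (pverts H)) * eccentricity_entry J (Inl u) (Inr h0)
            * eccentricity_entry J (Inr h0) (Inl v) / s)
      * det_on (pverts H) (\<lambda>h k. (if h = k then x + 2 else 0) + 2 * adjacency_entry H h k + (- 2))"
proof -
  define f where "f u v = (if u = v then x else 0) - eccentricity_entry J u v" for u v
  let ?S = "Inl ` pverts G \<union> Inr ` graph_edges G :: ('a + 'a set) set"
  let ?V = "Inl ` ?S :: (('a + 'a set) + 'b) set"
  let ?W = "Inr ` pverts H :: (('a + 'a set) + 'b) set"
  have finS: "finite ?S"
    using G.pair_finite_verts G.finite_graph_edges by simp
  have fin: "finite ?V" "finite ?W"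
    using finS H.pair_finite_verts by auto
  have inj: "inj_on Inr (pverts H)" "inj_on Inl ?S"
    by (auto simp: inj_on_def)
  have sum_W: "(\<Sum>w\<in>?W. k w) = (\<Sum>h\<in>pverts H. k (Inr h))"
    for k :: "('a + 'a set) + 'b \<Rightarrow> real"
    by (rule sum.reindex[OF inj(1), unfolded o_def])
  have self: "regular_join G H r"
    by (rule regular_join_axioms)
  \<comment> \<open>The + 2 in the first term cancels the constant - 2 on the diagonal, where the
    adjacency entry is 0.\<close>
  have f_H: "f (Inr h) (Inr h') = (if h = h' then x + 2 else 0) + 2 * adjacency_entry H h h' + (- 2)"
    if "h \<in> pverts H" "h' \<in> pverts H" for h h'
    using that H.no_loops' by (auto simp: f_def entry_join_join adjacency_entry_def)
  \<comment> \<open>Comparing the join with itself for two different vertices of \<open>H\<close>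
    shows that the coupling entries are constant along \<open>H\<close>; \<open>h0\<close> serves as
    representative.\<close>
  have f_VW: "f (Inl y) (Inr h) = - eccentricity_entry J (Inl y) (Inr h0)"
    "f (Inr h) (Inl y) = - eccentricity_entry J (Inr h0) (Inl y)"
    if "y \<in> ?S" "h \<in> pverts H" for y h
    using regular_joins_entry_eq(2,3)[OF self self that(1,1,2) h0] by (simp_all add: f_def)
  \<comment> \<open>The block on \<open>H\<close> has constant row sums \<open>s\<close>, so a
    solution constant in \<open>w\<close> is the coupling entry divided by \<open>s\<close>.\<close>
  define g where "g w v = - eccentricity_entry J (Inr h0) v / s" for w v :: "('a + 'a set) + 'b"
  have "det_on (?V \<union> ?W) f = det_on ?V (\<lambda>u v. f u v - (\<Sum>w\<in>?W. f u w * g w v)) * det_on ?W f"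
  proof (rule det_on_eliminate[OF fin])
    fix w v assume "w \<in> ?W" "v \<in> ?V"
    then obtain h y where hy: "w = Inr h" "h \<in> pverts H" "v = Inl y" "y \<in> ?S"
      by auto
    have "(\<Sum>w'\<in>?W. f w w')
        = (\<Sum>h'\<in>pverts H. (if h = h' then x + 2 else 0) + 2 * adjacency_entry H h h' + (- 2))"
      unfolding sum_W hy(1) using hy(2) by (intro sum.cong) (simp_all only: f_H)
    also have "\<dots> = (\<Sum>h'\<in>pverts H. if h = h' then x + 2 else 0)
        + 2 * (\<Sum>h'\<in>pverts H. adjacency_entry H h h') + (\<Sum>h'\<in>pverts H. - 2)"
      by (simp only: sum.distrib sum_distrib_left)
    also have "\<dots> = s"
      using hy(2) H.pair_finite_verts by (simp add: H.sum_adjacency_entry k s(1))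
    finally have "(\<Sum>w'\<in>?W. f w w' * g w' v) = s * g w v"
      by (simp only: g_def sum_distrib_right[symmetric])
    then show "(\<Sum>w'\<in>?W. f w w' * g w' v) = f w v"
      using s(2) hy(1,3) f_VW(2)[OF hy(4,2)] by (simp add: g_def)
  qed auto
  also have "det_on ?W f = det_on (pverts H)
      (\<lambda>h k. (if h = k then x + 2 else 0) + 2 * adjacency_entry H h k + (- 2))"
    unfolding det_on_reindex[OF H.pair_finite_verts inj(1)]
    using H.pair_finite_verts by (rule det_on_cong) (rule f_H)
  also have "det_on ?V (\<lambda>u v. f u v - (\<Sum>w\<in>?W. f u w * g w v)) = det_on ?S
        (\<lambda>u v. (if u = v then x else 0) - eccentricity_entry J (Inl u) (Inl v)
          - real (card (pverts H)) * eccentricity_entry J (Inl u) (Inr h0)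
            * eccentricity_entry J (Inr h0) (Inl v) / s)"
    unfolding det_on_reindex[OF finS inj(2)]
  proof (rule det_on_cong[OF finS])
    fix u v assume uv: "u \<in> ?S" "v \<in> ?S"
    have "(\<Sum>w\<in>?W. f (Inl u) w * g w (Inl v))
        = (\<Sum>h\<in>pverts H. eccentricity_entry J (Inl u) (Inr h0) * eccentricity_entry J (Inr h0) (Inl v) / s)"
      unfolding sum_W using uv by (intro sum.cong) (simp_all add: f_VW g_def)
    then show "f (Inl u) (Inl v) - (\<Sum>w\<in>?W. f (Inl u) w * g w (Inl v))
        = (if u = v then x else 0) - eccentricity_entry J (Inl u) (Inl v)
          - real (card (pverts H)) * eccentricity_entry J (Inl u) (Inr h0)
            * eccentricity_entry J (Inr h0) (Inl v) / s"
      by (simp add: f_def)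
  qed
  finally show ?thesis
    by (simp add: f_def[abs_def] pverts_subdivision_edge_join)
qed

end

section \<open>Recovering the factors from the join\<close>

text \<open>In a join \<open>G \<veebar> H\<close> the vertices of \<open>H\<close> will turn out to be exactly the hubs: the first clause
  excludes the vertices of \<open>S(G)\<close> at distance \<open>3\<close> from some other vertex. The other two are needed only
  for \<open>G = K\<^sub>2\<close>: the second excludes the subdivision vertex, which is then adjacent to all other
  vertices, and the third the two vertices of \<open>G\<close>, which then have degree \<open>1\<close>.\<close>

definition hub :: "'a pair_pre_digraph \<Rightarrow> 'a \<Rightarrow> bool" where
  "hub G x \<longleftrightarrow>
     (\<forall>y\<in>pverts G. x = y \<or> (x, y) \<in> parcs G \<or> (\<exists>z\<in>pverts G. (x, z) \<in> parcs G \<and> (z, y) \<in> parcs G))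
     \<and> (\<exists>y\<in>pverts G. x \<noteq> y \<and> (x, y) \<notin> parcs G)
     \<and> (\<exists>y\<in>pverts G. \<exists>z\<in>pverts G. y \<noteq> z \<and> (x, y) \<in> parcs G \<and> (x, z) \<in> parcs G)"

lemma hub_two_steps:
  assumes "hub G x" "y \<in> pverts G" "x \<noteq> y" "(x, y) \<notin> parcs G"
  obtains z where "(x, z) \<in> parcs G" "(z, y) \<in> parcs G"
  using assms unfolding hub_def by blast

text \<open>The property \<open>hub\<close> is first-order in adjacency and equality, so it is
  invariant under isomorphism.\<close>

lemma hub_iso:
  assumes "bij_betw \<phi> (pverts G) (pverts H)"
    and "\<And>u v. u \<in> pverts G \<Longrightarrow> v \<in> pverts G \<Longrightarrow> (u, v) \<in> parcs G \<longleftrightarrow> (\<phi> u, \<phi> v) \<in> parcs H"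
    and "x \<in> pverts G"
  shows "hub H (\<phi> x) \<longleftrightarrow> hub G x"
proof -
  have "\<phi> u = \<phi> v \<longleftrightarrow> u = v" if "u \<in> pverts G" "v \<in> pverts G" for u v
    using that assms(1) by (auto simp: bij_betw_def inj_on_eq_iff)
  then show ?thesis
    unfolding hub_def bij_betw_imp_surj_on[OF assms(1), symmetric]
    using assms(2,3) by simp
qed

context regular_join
begin

text \<open>Two steps reach everything through subdivision vertices, and vertices of
  \<open>G\<close> are nonadjacent to \<open>h\<close>. The assumption \<open>big\<close> supplies
  two neighbours: an edge of \<open>G\<close> together with either a neighbour in \<open>H\<close>
  or a second edge.\<close>

lemma hub_join:
  assumes h: "h \<in> pverts H"
    and big: "(\<exists>k. (h, k) \<in> parcs H) \<or> 2 \<le> card (graph_edges G)"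
  shows "hub J (Inr h)"
  unfolding hub_def
proof (intro conjI ballI)
  obtain e where e: "e \<in> graph_edges G"
    using ex_edge by blast
  obtain u where u: "u \<in> pverts G"
    using G_nonempty by blast
  show "\<exists>y\<in>pverts J. Inr h \<noteq> y \<and> (Inr h, y) \<notin> parcs J"
    using u by (intro bexI[of _ "Inl (Inl u)"]) auto
  show "Inr h = y \<or> (Inr h, y) \<in> parcs J \<or> (\<exists>z\<in>pverts J. (Inr h, z) \<in> parcs J \<and> (z, y) \<in> parcs J)"
    if y: "y \<in> pverts J" for y
  proof -
    consider (vertex) v where "y = Inl (Inl v)" "v \<in> pverts G"
      | (edge) f where "y = Inl (Inr f)" "f \<in> graph_edges G"
      | (join) k where "y = Inr k" "k \<in> pverts H"
      using y by (auto simp: pverts_subdivision_edge_join)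
    then show ?thesis
    proof cases
      case vertex
      then obtain f where "f \<in> graph_edges G" "v \<in> f"
        using ex_incident_edge by blast
      then show ?thesis
        using vertex h by (intro disjI2 bexI[of _ "Inl (Inr f)"]) auto
    next
      case edge
      then show ?thesis
        using h by simp
    next
      case join
      then show ?thesis
        using h e by (intro disjI2 bexI[of _ "Inl (Inr e)"]) auto
    qed
  qed
  show "\<exists>y\<in>pverts J. \<exists>z\<in>pverts J. y \<noteq> z \<and> (Inr h, y) \<in> parcs J \<and> (Inr h, z) \<in> parcs J"
    using big
  proof
    assume "\<exists>k. (h, k) \<in> parcs H"
    then obtain k where "(h, k) \<in> parcs H" "k \<in> pverts H"
      using H.in_arcsD2 by blast
    then show ?thesis
      using h e by (intro bexI[of _ "Inl (Inr e)"] bexI[of _ "Inr k"]) auto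
  next
    assume "2 \<le> card (graph_edges G)"
    then have "\<not> graph_edges G \<subseteq> {e}"
      using card_mono[of "{e}" "graph_edges G"] by auto
    then obtain f where "f \<in> graph_edges G" "f \<noteq> e"
      by blast
    then show ?thesis
      using h e by (intro bexI[of _ "Inl (Inr e)"] bexI[of _ "Inl (Inr f)"]) auto
  qed
qed

text \<open>The first clause would force \<open>e\<close> to contain every vertex of
  \<open>G\<close>. Then \<open>e\<close> is the only edge, and its subdivision vertex is adjacent
  to all other vertices, against the second clause.\<close>

lemma not_hub_edge:
  assumes e: "e \<in> graph_edges G"
  shows "\<not> hub J (Inl (Inr e))"
proof
  assume hub: "hub J (Inl (Inr e))"
  have all_incident: "u \<in> e" if "u \<in> pverts G" for u
  proof (rule ccontr)
    assume "u \<notin> e"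
    then have "Inl (Inl u) \<in> pverts J" "Inl (Inr e) \<noteq> Inl (Inl u)" "(Inl (Inr e), Inl (Inl u)) \<notin> parcs J"
      using that by simp_all
    from hub_two_steps[OF hub this] obtain z
      where "(Inl (Inr e), z) \<in> parcs J" "(z, Inl (Inl u)) \<in> parcs J" .
    then show False
      by (cases z; cases "projl z") auto
  qed
  obtain y where y: "y \<in> pverts J" "Inl (Inr e) \<noteq> y" "(Inl (Inr e), y) \<notin> parcs J"
    using hub unfolding hub_def by blast
  then obtain f where f: "f \<in> graph_edges G" "f \<noteq> e"
    using e all_incident by (auto simp: pverts_subdivision_edge_join)
  then obtain a b where "f = {a, b}" "a \<noteq> b" "a \<in> pverts G" "b \<in> pverts G"
    by (elim G.graph_edgesE)
  then show False
    using G.graph_edge_eqI[OF e, of a b] all_incident f by simp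
qed

text \<open>The first clause would put every edge through \<open>v\<close>. The third gives degree
  at least 2, and then a neighbour of \<open>v\<close> has an edge avoiding
  \<open>v\<close>.\<close>

lemma not_hub_vertex:
  assumes v: "v \<in> pverts G"
  shows "\<not> hub J (Inl (Inl v))"
proof
  assume hub: "hub J (Inl (Inl v))"
  have all_incident: "v \<in> e" if "e \<in> graph_edges G" for e
  proof (rule ccontr)
    assume "v \<notin> e"
    then have "Inl (Inr e) \<in> pverts J" "Inl (Inl v) \<noteq> Inl (Inr e)" "(Inl (Inl v), Inl (Inr e)) \<notin> parcs J"
      using that by simp_all
    from hub_two_steps[OF hub this] obtain z
      where "(Inl (Inl v), z) \<in> parcs J" "(z, Inl (Inr e)) \<in> parcs J" .
    then show False
      by (cases z; cases "projl z") auto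
  qed
  obtain y z where yz: "y \<noteq> z" "(Inl (Inl v), y) \<in> parcs J" "(Inl (Inl v), z) \<in> parcs J"
    using hub unfolding hub_def by blast
  then obtain e f where "e \<noteq> f" "e \<in> graph_edges G" "f \<in> graph_edges G" "v \<in> e" "v \<in> f"
    by (cases y; cases "projl y"; cases z; cases "projl z") auto
  then have "{e, f} \<subseteq> {e \<in> graph_edges G. v \<in> e}" "card {e, f} = 2"
    by auto
  then have "2 \<le> r"
    using card_mono[of "{e \<in> graph_edges G. v \<in> e}" "{e, f}"] G.finite_graph_edges
      G.card_incident_edges out_degree_G[OF v] by simp
  then obtain a where a: "(v, a) \<in> parcs G"
    using ex_other_neighbour[OF _ v] by blast
  obtain w where w: "(a, w) \<in> parcs G" "w \<noteq> v"
    using ex_other_neighbour[OF \<open>2 \<le> r\<close> G.in_arcsD2[OF a]] by blast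
  then have "{a, w} \<in> graph_edges G" "v \<notin> {a, w}"
    using a G.no_loops' by (auto simp: G.doubleton_in_graph_edges_iff)
  then show False
    using all_incident by blast
qed

lemma hub_iff:
  assumes "\<And>h. h \<in> pverts H \<Longrightarrow> (\<exists>k. (h, k) \<in> parcs H) \<or> 2 \<le> card (graph_edges G)"
    and "x \<in> pverts J"
  shows "hub J x \<longleftrightarrow> x \<in> Inr ` pverts H"
  using assms hub_join not_hub_edge not_hub_vertex
  by (auto simp: pverts_subdivision_edge_join)

lemma card_graph_edges: "2 * card (graph_edges G) = card (pverts G) * r"
  using G.handshake by (simp add: out_degree_G)

lemma card_pverts_J: "card (pverts J) = card (pverts G) + card (graph_edges G) + card (pverts H)"
proof -
  have "card (Inl ` pverts G \<union> Inr ` graph_edges G :: ('a + 'a set) set)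
      = card (pverts G) + card (graph_edges G)"
    using G.pair_finite_verts G.finite_graph_edges
    by (subst card_Un_disjoint) (auto simp: card_image)
  then show ?thesis
    unfolding pverts_subdivision_edge_join
    using G.pair_finite_verts G.finite_graph_edges H.pair_finite_verts
    by (subst card_Un_disjoint) (auto simp: card_image)
qed

lemma two_le_card_graph_edges:
  assumes "2 \<le> r"
  shows "2 \<le> card (graph_edges G)"
proof -
  obtain v where v: "v \<in> pverts G"
    using G_nonempty by blast
  have "2 \<le> card {e \<in> graph_edges G. v \<in> e}"
    using assms v by (simp add: G.card_incident_edges out_degree_G)
  also have "\<dots> \<le> card (graph_edges G)"
    using G.finite_graph_edges by (intro card_mono) auto
  finally show ?thesis .
qed

text \<open>Adjacency in \<open>G\<close> is recovered from the join as having a common neighbour, a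
  form that isomorphisms of joins preserve.\<close>

lemma ex_path_between_vertices_iff:
  assumes "u \<in> pverts G" "v \<in> pverts G"
  shows "(u, v) \<in> parcs G \<longleftrightarrow>
    u \<noteq> v \<and> (\<exists>z\<in>pverts J. (Inl (Inl u), z) \<in> parcs J \<and> (z, Inl (Inl v)) \<in> parcs J)"
proof
  assume uv: "(u, v) \<in> parcs G"
  then show "u \<noteq> v \<and> (\<exists>z\<in>pverts J. (Inl (Inl u), z) \<in> parcs J \<and> (z, Inl (Inl v)) \<in> parcs J)"
    using G.no_loops'[OF uv]
    by (intro conjI bexI[of _ "Inl (Inr {u, v})"]) (auto simp: G.doubleton_in_graph_edges_iff)
next
  assume "u \<noteq> v \<and> (\<exists>z\<in>pverts J. (Inl (Inl u), z) \<in> parcs J \<and> (z, Inl (Inl v)) \<in> parcs J)"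
  then obtain z where z: "u \<noteq> v" "(Inl (Inl u), z) \<in> parcs J" "(z, Inl (Inl v)) \<in> parcs J"
    by blast
  then obtain e where "e \<in> graph_edges G" "u \<in> e" "v \<in> e"
    by (cases z; cases "projl z") auto
  then show "(u, v) \<in> parcs G"
    using G.graph_edge_eqI z(1) by (metis G.doubleton_in_graph_edges_iff)
qed

end

section \<open>Restricting isomorphisms of joins to the factors\<close>

text \<open>Hubs go to hubs, so an isomorphism restricts to the second factors, which are induced
  subgraphs of the joins.\<close>

lemma iso_of_right_iso:
  assumes "regular_join K G r" "regular_join K G' r"
    and big: "\<And>h. h \<in> pverts G \<Longrightarrow> \<exists>k. (h, k) \<in> parcs G" "\<And>h. h \<in> pverts G' \<Longrightarrow> \<exists>k. (h, k) \<in> parcs G'"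
    and iso: "digraph_iso (with_proj (subdivision_edge_join K G)) (with_proj (subdivision_edge_join K G'))"
  shows "digraph_iso (with_proj G) (with_proj G')"
proof -
  interpret A: regular_join K G r by fact
  interpret B: regular_join K G' r by fact
  obtain \<phi> where \<phi>: "bij_betw \<phi> (pverts A.J) (pverts B.J)"
    "\<And>u v. u \<in> pverts A.J \<Longrightarrow> v \<in> pverts A.J \<Longrightarrow> (u, v) \<in> parcs A.J \<longleftrightarrow> (\<phi> u, \<phi> v) \<in> parcs B.J"
    using iso unfolding digraph_iso_with_proj_iff[OF A.J.pair_graph_axioms B.J.pair_graph_axioms] by blast
  have hub: "\<phi> x \<in> Inr ` pverts G' \<longleftrightarrow> x \<in> Inr ` pverts G" if "x \<in> pverts A.J" for x
    using hub_iso[OF \<phi> that] A.hub_iff[OF _ that] B.hub_iff[of "\<phi> x"] big that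
      bij_betw_apply[OF \<phi>(1) that] by blast
  define \<psi> where "\<psi> h = projr (\<phi> (Inr h))" for h
  have \<psi>: "\<phi> (Inr h) = Inr (\<psi> h)" "\<psi> h \<in> pverts G'" if "h \<in> pverts G" for h
    using hub[of "Inr h"] that by (auto simp: \<psi>_def)
  have "bij_betw \<psi> (pverts G) (pverts G')"
    unfolding bij_betw_def
  proof (intro conjI inj_onI equalityI subsetI)
    fix h k assume hk: "h \<in> pverts G" "k \<in> pverts G" "\<psi> h = \<psi> k"
    then have "\<phi> (Inr h) = \<phi> (Inr k)"
      by (simp add: \<psi>(1))
    then show "h = k"
      using hk bij_betw_imp_inj_on[OF \<phi>(1)] by (auto simp: inj_on_eq_iff)
  next
    fix k assume "k \<in> pverts G'"
    then have "Inr k \<in> \<phi> ` pverts A.J"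
      by (simp add: bij_betw_imp_surj_on[OF \<phi>(1)])
    then obtain x where x: "x \<in> pverts A.J" "\<phi> x = Inr k"
      by auto
    then obtain h where "h \<in> pverts G" "x = Inr h"
      using hub[OF x(1)] \<open>k \<in> pverts G'\<close> by auto
    then show "k \<in> \<psi> ` pverts G"
      using x(2) \<psi>(1) by auto
  qed (use \<psi>(2) in auto)
  moreover have "(h, k) \<in> parcs G \<longleftrightarrow> (\<psi> h, \<psi> k) \<in> parcs G'" if "h \<in> pverts G" "k \<in> pverts G" for h k
    using \<phi>(2)[of "Inr h" "Inr k"] that by (simp add: \<psi>(1))
  ultimately show ?thesis
    unfolding digraph_iso_with_proj_iff[OF A.H.pair_graph_axioms B.H.pair_graph_axioms] by blast
qed

lemma iso_of_left_iso:
  fixes G :: "'a pair_pre_digraph" and G' :: "'b pair_pre_digraph" and K :: "'c pair_pre_digraph"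
  assumes "regular_join G K r" "regular_join G' K r" and r: "2 \<le> r"
    and iso: "digraph_iso (with_proj (subdivision_edge_join G K)) (with_proj (subdivision_edge_join G' K))"
  shows "digraph_iso (with_proj G) (with_proj G')"
proof -
  interpret A: regular_join G K r by fact
  interpret B: regular_join G' K r by fact
  obtain \<phi> where \<phi>: "bij_betw \<phi> (pverts A.J) (pverts B.J)"
    "\<And>u v. u \<in> pverts A.J \<Longrightarrow> v \<in> pverts A.J \<Longrightarrow> (u, v) \<in> parcs A.J \<longleftrightarrow> (\<phi> u, \<phi> v) \<in> parcs B.J"
    using iso unfolding digraph_iso_with_proj_iff[OF A.J.pair_graph_axioms B.J.pair_graph_axioms] by blast
  have eq_iff: "\<phi> u = \<phi> v \<longleftrightarrow> u = v" if "u \<in> pverts A.J" "v \<in> pverts A.J" for u v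
    using bij_betw_imp_inj_on[OF \<phi>(1)] that by (simp add: inj_on_eq_iff)
  have mem: "\<phi> x \<in> pverts B.J" if "x \<in> pverts A.J" for x
    using bij_betw_apply[OF \<phi>(1) that] .
  have surj: "\<exists>x\<in>pverts A.J. y = \<phi> x" if "y \<in> pverts B.J" for y
    using that bij_betw_imp_surj_on[OF \<phi>(1)] by blast
  \<comment> \<open>Degree at least 2 gives two edges in each first factor, so the hub criterion
    holds even if \<open>K\<close> is a single vertex.\<close>
  have hub: "\<phi> x \<in> Inr ` pverts K \<longleftrightarrow> x \<in> Inr ` pverts K" if "x \<in> pverts A.J" for x
    using hub_iso[OF \<phi> that] A.hub_iff[OF _ that] B.hub_iff[OF _ mem[OF that]]
      A.two_le_card_graph_edges[OF r] B.two_le_card_graph_edges[OF r] by blast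
  \<comment> \<open>Among the vertices that are not hubs, those of \<open>G\<close> are the ones
    adjacent to no hub: every subdivision vertex is adjacent to all of the nonempty set of
    hubs.\<close>
  have vertex_A: "x \<in> range (Inl \<circ> Inl) \<longleftrightarrow> x \<notin> Inr ` pverts K \<and> (\<forall>h\<in>Inr ` pverts K. (x, h) \<notin> parcs A.J)"
    if "x \<in> pverts A.J" for x
    using that A.H_nonempty by (auto simp: pverts_subdivision_edge_join)
  have vertex_B: "x \<in> range (Inl \<circ> Inl) \<longleftrightarrow> x \<notin> Inr ` pverts K \<and> (\<forall>h\<in>Inr ` pverts K. (x, h) \<notin> parcs B.J)"
    if "x \<in> pverts B.J" for x
    using that A.H_nonempty by (auto simp: pverts_subdivision_edge_join)
  have hubs: "\<phi> ` Inr ` pverts K = Inr ` pverts K"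
  proof (rule equalityI; rule subsetI)
    fix y :: "('b + 'b set) + 'c" assume y: "y \<in> Inr ` pverts K"
    then have "y \<in> pverts B.J"
      by auto
    from surj[OF this] obtain x where "x \<in> pverts A.J" "y = \<phi> x"
      by blast
    then show "y \<in> \<phi> ` Inr ` pverts K"
      using hub y by blast
  next
    fix y assume "y \<in> \<phi> ` Inr ` pverts K"
    then obtain h where "h \<in> pverts K" "y = \<phi> (Inr h)"
      by blast
    then show "y \<in> Inr ` pverts K"
      using hub[of "Inr h"] by simp
  qed
  have vertex: "\<phi> x \<in> range (Inl \<circ> Inl) \<longleftrightarrow> x \<in> range (Inl \<circ> Inl)" if x: "x \<in> pverts A.J" for x
  proof -
    have "(\<forall>h\<in>\<phi> ` Inr ` pverts K. (\<phi> x, h) \<notin> parcs B.J) \<longleftrightarrow> (\<forall>h\<in>Inr ` pverts K. (x, h) \<notin> parcs A.J)"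
      using \<phi>(2)[OF x] by auto
    then show ?thesis
      unfolding vertex_A[OF x] vertex_B[OF mem[OF x]] hubs hub[OF x] by blast
  qed
  define \<psi> where "\<psi> v = projl (projl (\<phi> (Inl (Inl v))))" for v
  have \<psi>: "\<phi> (Inl (Inl v)) = Inl (Inl (\<psi> v))" "\<psi> v \<in> pverts G'" if "v \<in> pverts G" for v
  proof -
    have "\<phi> (Inl (Inl v)) \<in> range (Inl \<circ> Inl)"
      using vertex[of "Inl (Inl v)"] that by auto
    then show "\<phi> (Inl (Inl v)) = Inl (Inl (\<psi> v))"
      by (auto simp: \<psi>_def)
    then show "\<psi> v \<in> pverts G'"
      using mem[of "Inl (Inl v)"] that by simp
  qed
  have "bij_betw \<psi> (pverts G) (pverts G')"
    unfolding bij_betw_def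
  proof (intro conjI inj_onI equalityI subsetI)
    fix u v assume uv: "u \<in> pverts G" "v \<in> pverts G" "\<psi> u = \<psi> v"
    then have "\<phi> (Inl (Inl u)) = \<phi> (Inl (Inl v))"
      by (simp add: \<psi>(1))
    then show "u = v"
      using uv eq_iff by simp
  next
    fix v assume v: "v \<in> pverts G'"
    then have "Inl (Inl v) \<in> pverts B.J"
      by simp
    from surj[OF this] obtain x where x: "x \<in> pverts A.J" "Inl (Inl v) = \<phi> x"
      by blast
    then have "x \<in> range (Inl \<circ> Inl)"
      using vertex[OF x(1)] by (metis comp_apply rangeI)
    then obtain u where "x = Inl (Inl u)" "u \<in> pverts G"
      using x(1) by auto
    then show "v \<in> \<psi> ` pverts G"
      using x(2) \<psi>(1) by auto
  qed (use \<psi>(2) in auto)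
  moreover have "(u, v) \<in> parcs G \<longleftrightarrow> (\<psi> u, \<psi> v) \<in> parcs G'" if uv: "u \<in> pverts G" "v \<in> pverts G" for u v
  proof -
    have "(\<exists>z\<in>pverts B.J. (Inl (Inl (\<psi> u)), z) \<in> parcs B.J \<and> (z, Inl (Inl (\<psi> v))) \<in> parcs B.J)
        \<longleftrightarrow> (\<exists>z\<in>pverts A.J. (Inl (Inl u), z) \<in> parcs A.J \<and> (z, Inl (Inl v)) \<in> parcs A.J)"
      using uv unfolding bij_betw_imp_surj_on[OF \<phi>(1), symmetric]
      by (simp add: \<phi>(2) flip: \<psi>(1))
    moreover have "\<psi> u = \<psi> v \<longleftrightarrow> u = v"
      using eq_iff[of "Inl (Inl u)" "Inl (Inl v)"] uv by (simp add: \<psi>(1))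
    ultimately show ?thesis
      unfolding A.ex_path_between_vertices_iff[OF uv]
        B.ex_path_between_vertices_iff[OF \<psi>(2)[OF uv(1)] \<psi>(2)[OF uv(2)]] by simp
  qed
  ultimately show ?thesis
    unfolding digraph_iso_with_proj_iff[OF A.G.pair_graph_axioms B.G.pair_graph_axioms] by blast
qed

section \<open>Cospectrality of joins\<close>

text \<open>With at most one neighbour each, a walk from \<open>u\<close> can only go back and forth
  along a single edge, so connectedness leaves no vertex beyond it. This serves to exclude degree 0
  and 1 for the cospectral pair.\<close>

lemma (in pair_graph) complete_of_out_degree_le_1:
  assumes "Digraph_Component.connected G" "\<And>v. v \<in> pverts G \<Longrightarrow> out_degree G v \<le> 1"
    and uv: "u \<in> pverts G" "v \<in> pverts G" "u \<noteq> v"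
  shows "(u, v) \<in> parcs G"
proof -
  have unique: "x = y" if "(w, x) \<in> parcs G" "(w, y) \<in> parcs G" for w x y
  proof -
    have "finite {z. (w, z) \<in> parcs G}"
      using pair_finite_verts by (rule rev_finite_subset) (use in_arcsD2 in auto)
    moreover have "card {z. (w, z) \<in> parcs G} \<le> Suc 0"
      using assms(2)[of w] in_arcsD1[OF that(1)] by (simp add: out_degree_eq_card)
    ultimately show ?thesis
      using that by (simp add: card_le_Suc0_iff_eq)
  qed
  have "u \<rightarrow>\<^sup>*\<^bsub>with_proj G\<^esub> v"
    using symmetric_connected_imp_strongly_connected[OF sym_arcs assms(1)] uv
    by (simp add: strongly_connected_def)
  then obtain p where "awalk u p v"
    by (auto simp: reachable_awalk)
  then have "(u, v) \<in> (parcs G)\<^sup>*"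
    using ex_awalk_length_iff[OF uv(1)] relpow_imp_rtrancl by blast
  then have "v = u \<or> (u, v) \<in> parcs G"
  proof (induction rule: rtrancl_induct)
    case (step y z)
    then show ?case
      using unique arcs_symmetric by blast
  qed simp
  then show ?thesis
    using uv(3) by blast
qed

lemma digraph_iso_of_complete:
  assumes "pair_graph G" "pair_graph H" "card (pverts G) = card (pverts H)"
    and "\<And>u v. u \<in> pverts G \<Longrightarrow> v \<in> pverts G \<Longrightarrow> u \<noteq> v \<Longrightarrow> (u, v) \<in> parcs G"
    and "\<And>u v. u \<in> pverts H \<Longrightarrow> v \<in> pverts H \<Longrightarrow> u \<noteq> v \<Longrightarrow> (u, v) \<in> parcs H"
  shows "digraph_iso (with_proj G) (with_proj H)"
proof -
  interpret G: pair_graph G by fact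
  interpret H: pair_graph H by fact
  obtain \<phi> where \<phi>: "bij_betw \<phi> (pverts G) (pverts H)"
    using finite_same_card_bij[OF G.pair_finite_verts H.pair_finite_verts assms(3)] by blast
  moreover have "(u, v) \<in> parcs G \<longleftrightarrow> (\<phi> u, \<phi> v) \<in> parcs H"
    if "u \<in> pverts G" "v \<in> pverts G" for u v
  proof -
    have "(u, v) \<in> parcs G \<longleftrightarrow> u \<noteq> v"
      using assms(4) that G.no_loops' by blast
    moreover have "(\<phi> u, \<phi> v) \<in> parcs H \<longleftrightarrow> \<phi> u \<noteq> \<phi> v"
      using assms(5) bij_betw_apply[OF \<phi>] that H.no_loops' by blast
    moreover have "\<phi> u = \<phi> v \<longleftrightarrow> u = v"
      using bij_betw_imp_inj_on[OF \<phi>] that by (simp add: inj_on_eq_iff)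
    ultimately show ?thesis
      by simp
  qed
  ultimately show ?thesis
    unfolding digraph_iso_with_proj_iff[OF assms(1,2)] by blast
qed

lemma finite_quadratic_roots: "finite {x :: real. x\<^sup>2 + p * x + q = 0}"
proof -
  have "{x. x\<^sup>2 + p * x + q = 0} = {x. poly [:q, p, 1:] x = 0}"
    by (auto simp: algebra_simps power2_eq_square)
  then show ?thesis
    using poly_roots_finite[of "[:q, p, 1:]"] by simp
qed

section \<open>Comparing the eccentricity spectra of joins\<close>

lemma eccentricity_spectrum_left_eq:
  assumes "regular_join G K r" "regular_join G' K r" and r: "2 \<le> r"
    and card: "card (pverts G) = card (pverts G')"
    and char: "\<And>x. det_on (pverts G) (\<lambda>u v. (if u = v then x else 0) - adjacency_entry G u v)
      = det_on (pverts G') (\<lambda>u v. (if u = v then x else 0) - adjacency_entry G' u v)"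
  shows "eccentricity_spectrum (subdivision_edge_join G K) = eccentricity_spectrum (subdivision_edge_join G' K)"
proof -
  interpret A: regular_join G K r by fact
  interpret B: regular_join G' K r by fact
  define n where "n = real (card (pverts G))"
  define m where "m = real (card (graph_edges G))"
  have edges: "card (graph_edges G') = card (graph_edges G)"
    using A.card_graph_edges B.card_graph_edges card by simp
  \<comment> \<open>The excluded values are 0 and the zeros of x (a + b r) and x s: the first
    elimination divides by \<open>x\<close>, the second by \<open>s\<close>, and the comparison of
    \<open>det N\<close> requires a + b r to be nonzero.\<close>
  let ?X = "{0} \<union> {x. x\<^sup>2 + (4 + 4 * real r) * x + - 18 * real r = 0}
    \<union> {x. x\<^sup>2 + (4 + 4 * real r - 4 * n) * x + (- 18 * real r - 9 * n * (m - 2 * real r)) = 0}"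
  show ?thesis
    unfolding eccentricity_spectrum_def
  proof (rule spectrum_on_eqI[OF A.finite_pverts_J B.finite_pverts_J])
    show "finite ?X"
      by (intro finite_UnI finite_quadratic_roots) simp
    fix x assume x: "x \<notin> ?X"
    define a where "a = x + 4 - 9 * real r / x"
    define b where "b = 4 - 9 / x"
    define c where "c = - 4 - 9 / x * (m - 2 * real r)"
    define s where "s = a + b * real r + c * n"
    have "x \<noteq> 0"
      using x by simp
    then have "x * (a + b * real r) = x\<^sup>2 + (4 + 4 * real r) * x + - 18 * real r"
      and "x * s = x\<^sup>2 + (4 + 4 * real r - 4 * n) * x + (- 18 * real r - 9 * n * (m - 2 * real r))"
      by (simp_all add: a_def b_def c_def s_def field_simps power2_eq_square)
    then have "a + b * real r \<noteq> 0" "s \<noteq> 0"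
      using x by auto
    note ab = a_def b_def c_def[unfolded m_def] s_def[unfolded n_def] \<open>s \<noteq> 0\<close>
    have "det_on (pverts G) (\<lambda>u v. (if u = v then a else 0) + b * adjacency_entry G u v + c)
        = det_on (pverts G') (\<lambda>u v. (if u = v then a else 0) + b * adjacency_entry G' u v + c)"
      by (rule det_on_regular_eq[OF A.G.pair_finite_verts B.G.pair_finite_verts card char
            A.adjacency_row_sum B.adjacency_row_sum \<open>a + b * real r \<noteq> 0\<close>])
    then show "det_on (pverts A.J) (\<lambda>u v. (if u = v then x else 0) - eccentricity_entry A.J u v)
        = det_on (pverts B.J) (\<lambda>u v. (if u = v then x else 0) - eccentricity_entry B.J u v)"
      unfolding A.det_on_join_char[OF r \<open>x \<noteq> 0\<close> ab]
        B.det_on_join_char[OF r \<open>x \<noteq> 0\<close> ab[unfolded card edges[symmetric]]]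
      by (simp only: edges card)
  qed
qed

lemma eccentricity_spectrum_right_eq:
  assumes AB: "regular_join K G k" "regular_join K G' k"
    and card: "card (pverts G) = card (pverts G')"
    and r: "\<And>v. v \<in> pverts G \<Longrightarrow> out_degree G v = r" "\<And>v. v \<in> pverts G' \<Longrightarrow> out_degree G' v = r"
    and char: "\<And>x. det_on (pverts G) (\<lambda>u v. (if u = v then x else 0) - adjacency_entry G u v)
      = det_on (pverts G') (\<lambda>u v. (if u = v then x else 0) - adjacency_entry G' u v)"
  shows "eccentricity_spectrum (subdivision_edge_join K G) = eccentricity_spectrum (subdivision_edge_join K G')"
proof -
  interpret A: regular_join K G k by fact
  interpret B: regular_join K G' k by fact
  obtain g g' where g: "g \<in> pverts G" "g' \<in> pverts G'"
    using A.H_nonempty B.H_nonempty by blast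
  let ?S = "Inl ` pverts K \<union> Inr ` graph_edges K"
  have finS: "finite ?S"
    using A.G.pair_finite_verts A.G.finite_graph_edges by simp
  show ?thesis
    unfolding eccentricity_spectrum_def
  proof (rule spectrum_on_eqI[OF A.finite_pverts_J B.finite_pverts_J])
    \<comment> \<open>The block on the second factor is (x + 2) I + 2 A - 2 J. The first value is
      where its row sum without the J term vanishes, the second where its full row sum
      \<open>s\<close> does.\<close>
    let ?X = "{- 2 - 2 * real r, 2 * real (card (pverts G)) - 2 - 2 * real r}"
    show "finite ?X"
      by simp
    fix x assume x: "x \<notin> ?X"
    define s where "s = x + 2 + 2 * real r - 2 * real (card (pverts G))"
    have s: "s \<noteq> 0" "x + 2 + 2 * real r \<noteq> 0"
      using x by (auto simp: s_def)
    have "det_on ?S (\<lambda>u v. (if u = v then x else 0) - eccentricity_entry A.J (Inl u) (Inl v)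
          - real (card (pverts G)) * eccentricity_entry A.J (Inl u) (Inr g)
            * eccentricity_entry A.J (Inr g) (Inl v) / s)
        = det_on ?S (\<lambda>u v. (if u = v then x else 0) - eccentricity_entry B.J (Inl u) (Inl v)
          - real (card (pverts G')) * eccentricity_entry B.J (Inl u) (Inr g')
            * eccentricity_entry B.J (Inr g') (Inl v) / s)"
      using regular_joins_entry_eq[OF AB _ _ g] by (intro det_on_cong[OF finS]) (simp only: card)
    moreover have "det_on (pverts G) (\<lambda>u v. (if u = v then x + 2 else 0) + 2 * adjacency_entry G u v + - 2)
        = det_on (pverts G') (\<lambda>u v. (if u = v then x + 2 else 0) + 2 * adjacency_entry G' u v + - 2)"
      using s(2) r A.H.sum_adjacency_entry B.H.sum_adjacency_entry
      by (intro det_on_regular_eq[OF A.H.pair_finite_verts B.H.pair_finite_verts card char]) simp_all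
    ultimately show "det_on (pverts A.J) (\<lambda>u v. (if u = v then x else 0) - eccentricity_entry A.J u v)
        = det_on (pverts B.J) (\<lambda>u v. (if u = v then x else 0) - eccentricity_entry B.J u v)"
      by (simp only: A.det_on_join_char'[OF _ s_def s(1) g(1)] r
          B.det_on_join_char'[OF _ s_def[unfolded card] s(1) g(2)])
  qed
qed

theorem corollary4p3:
  fixes G1 :: "'a pair_pre_digraph"
    and G2 :: "'b pair_pre_digraph"
    and H :: "'c pair_pre_digraph"
  assumes "pair_graph G1" "Digraph_Component.connected G1" "regular_graph G1"
    and "pair_graph G2" "Digraph_Component.connected G2" "regular_graph G2"
    and "cospectral G1 G2"
    and "pair_graph H" "Digraph_Component.connected H" "regular_graph H"
  shows "eccentricity_cospectral (subdivision_edge_join G1 H) (subdivision_edge_join G2 H)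
    \<and> (parcs H \<noteq> {} \<longrightarrow>
         eccentricity_cospectral (subdivision_edge_join H G1) (subdivision_edge_join H G2))"
proof -
  interpret G1: pair_graph G1 by fact
  interpret G2: pair_graph G2 by fact
  interpret H: pair_graph H by fact
  obtain r where r: "\<And>v. v \<in> pverts G1 \<Longrightarrow> out_degree G1 v = r"
    using \<open>regular_graph G1\<close> unfolding regular_graph_def by blast
  obtain r' where r': "\<And>v. v \<in> pverts G2 \<Longrightarrow> out_degree G2 v = r'"
    using \<open>regular_graph G2\<close> unfolding regular_graph_def by blast
  obtain k where k: "\<And>v. v \<in> pverts H \<Longrightarrow> out_degree H v = k"
    using \<open>regular_graph H\<close> unfolding regular_graph_def by blast
  have noniso: "\<not> digraph_iso (with_proj G1) (with_proj G2)"
    and card: "card (pverts G1) = card (pverts G2)"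
    and spectrum: "spectrum_on (pverts G1) (adjacency_entry G1) = spectrum_on (pverts G2) (adjacency_entry G2)"
    using \<open>cospectral G1 G2\<close> by (auto simp: cospectral_def adjacency_spectrum_def)
  note char = det_on_char_eq_of_spectrum_on_eq[OF G1.pair_finite_verts G2.pair_finite_verts spectrum]
  have nonempty: "pverts G1 \<noteq> {}" "pverts G2 \<noteq> {}" "pverts H \<noteq> {}"
    using assms(2,5,9) by (auto simp: connected_def strongly_connected_def mk_symmetric_def)
  \<comment> \<open>The spectra agree, and the degree is read off as the largest real
    eigenvalue.\<close>
  have "real r = real r'"
  proof (rule row_sums_eq_of_det_on_char_eq[OF G1.pair_finite_verts nonempty(1) _ _
        G2.pair_finite_verts nonempty(2) _ _ char])
    show "(\<Sum>v\<in>pverts G1. adjacency_entry G1 u v) = real r" if "u \<in> pverts G1" for u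
      using that by (simp add: G1.sum_adjacency_entry r)
    show "(\<Sum>v\<in>pverts G2. adjacency_entry G2 u v) = real r'" if "u \<in> pverts G2" for u
      using that by (simp add: G2.sum_adjacency_entry r')
  qed (simp_all add: adjacency_entry_def)
  with r' have r': "\<And>v. v \<in> pverts G2 \<Longrightarrow> out_degree G2 v = r"
    by simp
  \<comment> \<open>Connected graphs of degree at most 1 are complete, hence determined up to
    isomorphism by their order, and the two graphs are not isomorphic.\<close>
  have "2 \<le> r"
  proof (rule ccontr)
    assume "\<not> 2 \<le> r"
    then have "\<And>v. v \<in> pverts G1 \<Longrightarrow> out_degree G1 v \<le> 1" "\<And>v. v \<in> pverts G2 \<Longrightarrow> out_degree G2 v \<le> 1"
      using r r' by simp_all
    then have "digraph_iso (with_proj G1) (with_proj G2)"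
      using G1.complete_of_out_degree_le_1[OF assms(2)] G2.complete_of_out_degree_le_1[OF assms(5)]
      by (intro digraph_iso_of_complete assms(1,4) card) auto
    with noniso show False ..
  qed
  have "eccentricity_cospectral (subdivision_edge_join G1 H) (subdivision_edge_join G2 H)"
  proof -
    have A: "regular_join G1 H r" and B: "regular_join G2 H r"
      using nonempty r r' \<open>2 \<le> r\<close> by unfold_locales auto
    interpret A: regular_join G1 H r by fact
    interpret B: regular_join G2 H r by fact
    have "card (graph_edges G1) = card (graph_edges G2)"
      using A.card_graph_edges B.card_graph_edges card by simp
    then have "card (pverts A.J) = card (pverts B.J)"
      using card by (simp add: A.card_pverts_J B.card_pverts_J)
    then show ?thesis
      unfolding eccentricity_cospectral_def
      using A.J.pair_graph_axioms B.J.pair_graph_axioms A.connected_J B.connected_J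
        iso_of_left_iso[OF A B \<open>2 \<le> r\<close>] noniso
        eccentricity_spectrum_left_eq[OF A B \<open>2 \<le> r\<close> card char] by blast
  qed
  moreover have "eccentricity_cospectral (subdivision_edge_join H G1) (subdivision_edge_join H G2)"
    if edge: "parcs H \<noteq> {}"
  proof -
    obtain u v where uv: "(u, v) \<in> parcs H"
      using edge by auto
    have "finite {w. (u, w) \<in> parcs H}"
      using H.pair_finite_verts by (rule rev_finite_subset) (use H.in_arcsD2 in auto)
    then have "0 < card {w. (u, w) \<in> parcs H}"
      using uv by (auto simp: card_gt_0_iff)
    then have "0 < k"
      using k[OF H.in_arcsD1[OF uv]] by (simp add: H.out_degree_eq_card)
    then have A: "regular_join H G1 k" and B: "regular_join H G2 k"
      using nonempty k by unfold_locales auto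
    interpret A: regular_join H G1 k by fact
    interpret B: regular_join H G2 k by fact
    \<comment> \<open>A neighbour inside the second factor secures the hub criterion even when
      \<open>H\<close> has only one edge.\<close>
    have "\<exists>w. (v, w) \<in> parcs G1" if "v \<in> pverts G1" for v
      using r[OF that] \<open>2 \<le> r\<close> by (cases "{w. (v, w) \<in> parcs G1} = {}") (auto simp: G1.out_degree_eq_card)
    moreover have "\<exists>w. (v, w) \<in> parcs G2" if "v \<in> pverts G2" for v
      using r'[OF that] \<open>2 \<le> r\<close> by (cases "{w. (v, w) \<in> parcs G2} = {}") (auto simp: G2.out_degree_eq_card)
    ultimately have "\<not> digraph_iso (with_proj A.J) (with_proj B.J)"
      using iso_of_right_iso[OF A B] noniso by blast
    moreover have "card (pverts A.J) = card (pverts B.J)"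
      using card by (simp add: A.card_pverts_J B.card_pverts_J)
    ultimately show ?thesis
      unfolding eccentricity_cospectral_def
      using A.J.pair_graph_axioms B.J.pair_graph_axioms A.connected_J B.connected_J
        eccentricity_spectrum_right_eq[OF A B card r r' char] by blast
  qed
  ultimately show ?thesis
    by blast
qed

end
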